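(* Let $X$ be a real random variable with $\mathbb{E}X=0$, $\mathbb{E}X^2=1$, $\mathbb{E}X^4<\infty$, and put $v=\mathbb{E}X^4-1$. For each $n$ let $1\le d=d_n\le n$ be an integer, $p=\binom nd$, and $N=N_n\ge1$ an integer, and assume that as $n\to\infty$, $d^2/n\to\lambda\in[0,\infty)$ and $p/N\to c\in(0,\infty)$. Let $x\in\mathbb{R}^p$ be the degree-$d$ square-free tensor built from $n$ i.i.d. copies of $X$ and $R_n=\|x\|^2/p$. Then there exists a deterministic sequence $\varepsilon_n\to0$ such that for every deterministic complex $p\times p$ matrix $A$, \[ \mathbb{E}\left|\frac{x^{\mathsf T}Ax}{p}-R_n\frac{\operatorname{Tr}A}{p}\right|^2\le\varepsilon_n\|A\|_{\mathrm{op}}^2 . \] For all sufficiently large $n$, one may take \[ \varepsilon_n=\Bigl(\sqrt{\varepsilon_n^{\mathrm{diag}}}+\sqrt{\varepsilon_n^{\mathrm{off}}}\Bigr)^2, \] where \[ \varepsilon_n^{\mathrm{diag}}=\frac{vd}{n-d}\,e^{vd^2/(n-d)},\qquad \varepsilon_n^{\mathrm{off}}=\frac{8d(n-d)}{n(n-1)}\exp\!\left(\frac{2vd^2}{n-d}\right). \]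
   Context: Let $X_1,\dots,X_n$ be i.i.d. copies of $X$. Index coordinates of $\mathbb{R}^p$, $p=\binom nd$, by the $d$-element subsets $I$ of $[n]=\{1,\dots,n\}$. The square-free (principal) tensor of degree $d$ is the random vector $x=(x_I)_I\in\mathbb{R}^p$ with $x_I=\prod_{i\in I}X_i$; thus $R_n=\|x\|^2/p=\binom nd^{-1}\sum_{|I|=d}\prod_{i\in I}X_i^2$. $\|\cdot\|$ is the Euclidean norm and $\|\cdot\|_{\mathrm{op}}$ the operator (spectral) norm. $x^{\mathsf T}$ is the transpose. *)

theory Defs
  imports "HOL-Probability.Probability" "HOL-Library.Ramsey"
begin

text \<open>
  Vectors and matrices whose coordinates are indexed by a finite set \<open>S\<close> are functions
  \<open>'i \<Rightarrow> _\<close> and \<open>'i \<Rightarrow> 'i \<Rightarrow> _\<close>; only the values on \<open>S\<close> matter. For the degree-\<open>d\<close> tensors the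
  index set is \<open>nsets {1..n} d\<close>, the set of \<open>d\<close>-element subsets of \<open>{1..n}\<close>.
\<close>

text \<open>The set of values is bounded above whenever \<open>S\<close> is finite, so the supremum is genuine.\<close>

definition mat_op_norm :: "'i set \<Rightarrow> ('i \<Rightarrow> 'i \<Rightarrow> complex) \<Rightarrow> real" where
  "mat_op_norm S A =
     (SUP z \<in> {z. L2_set (\<lambda>i. cmod (z i)) S \<le> 1}.
        L2_set (\<lambda>i. cmod (\<Sum>j\<in>S. A i j * z j)) S)"

definition mat_trace :: "'i set \<Rightarrow> ('i \<Rightarrow> 'i \<Rightarrow> complex) \<Rightarrow> complex" where
  "mat_trace S A = (\<Sum>i\<in>S. A i i)"

text \<open>\<open>x\<^sup>T A x\<close> for a real vector \<open>x\<close>.\<close>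

definition quad_form :: "'i set \<Rightarrow> ('i \<Rightarrow> 'i \<Rightarrow> complex) \<Rightarrow> ('i \<Rightarrow> real) \<Rightarrow> complex" where
  "quad_form S A x =
     (\<Sum>i\<in>S. \<Sum>j\<in>S. complex_of_real (x i) * A i j * complex_of_real (x j))"

definition sqfree_tensor :: "(nat \<Rightarrow> 'a \<Rightarrow> real) \<Rightarrow> 'a \<Rightarrow> nat set \<Rightarrow> real" where
  "sqfree_tensor Y \<omega> I = (\<Prod>i\<in>I. Y i \<omega>)"

definition tensor_R :: "nat \<Rightarrow> nat \<Rightarrow> (nat \<Rightarrow> 'a \<Rightarrow> real) \<Rightarrow> 'a \<Rightarrow> real" where
  "tensor_R n d Y \<omega> =
     (L2_set (sqfree_tensor Y \<omega>) (nsets {1..n} d))\<^sup>2 / real (n choose d)"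

definition quad_form_dev ::
    "nat \<Rightarrow> nat \<Rightarrow> (nat \<Rightarrow> 'a \<Rightarrow> real) \<Rightarrow> (nat set \<Rightarrow> nat set \<Rightarrow> complex) \<Rightarrow> 'a \<Rightarrow> complex" where
  "quad_form_dev n d Y A \<omega> =
     quad_form (nsets {1..n} d) A (sqfree_tensor Y \<omega>) / of_nat (n choose d)
     - complex_of_real (tensor_R n d Y \<omega>) * (mat_trace (nsets {1..n} d) A / of_nat (n choose d))"

definition eps_diag :: "real \<Rightarrow> nat \<Rightarrow> nat \<Rightarrow> real" where
  "eps_diag v d n =
     v * real d / (real n - real d) * exp (v * (real d)\<^sup>2 / (real n - real d))"

definition eps_off :: "real \<Rightarrow> nat \<Rightarrow> nat \<Rightarrow> real" where
  "eps_off v d n =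
     8 * real d * (real n - real d) / (real n * (real n - 1))
       * exp (2 * v * (real d)\<^sup>2 / (real n - real d))"

end

theory Submission
  imports Defs
begin

text \<open>  Write \<open>p = n choose d\<close> and let \<open>x\<^sub>I\<close> be the product of the \<open>Y i\<close> over \<open>I\<close>. Since the
  coordinates satisfy \<open>p * R\<^sub>n = \<Sum>\<^sub>I x\<^sub>I\<^sup>2\<close>, the deviation times \<open>p\<close> splits into a diagonal
  form \<open>\<Sum>\<^sub>I b\<^sub>I * x\<^sub>I\<^sup>2\<close>, where \<open>b\<close> is the diagonal of \<open>A\<close> minus its mean, and an off-diagonal
  form \<open>\<Sum>\<^sub>I\<^sub>J A\<^sub>I\<^sub>J * x\<^sub>I * x\<^sub>J\<close> over \<open>I \<noteq> J\<close>. The two second moments are bounded separately and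
  combined by Minkowski's inequality. In both, the coefficients enter through the Frobenius norm of
  \<open>A\<close>, whose square is at most \<open>p\<close> times the squared operator norm.

  Put \<open>u\<^sub>i = (Y i)\<^sup>2 - 1\<close>, a centred variable of variance \<open>v\<close>. Expanding the squares in
  \<open>x\<^sub>I * x\<^sub>J\<close> as \<open>1 + u\<^sub>i\<close> gives
  \<open>x\<^sub>I * x\<^sub>J = \<Sum>\<^sub>K chaos T K\<close> with \<open>T = sym_diff I J\<close> and \<open>K\<close> ranging over the subsets of
  \<open>I \<inter> J\<close>, where \<open>chaos T K\<close> is the product of \<open>Y i\<close> over \<open>T\<close> and of \<open>u\<^sub>i\<close> over \<open>K\<close>
  (\<open>monomial_mult_eq_sum_chaos\<close>). It has second moment \<open>v ^ card K\<close>, and two such terms are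
  orthogonal unless their supports \<open>T \<union> K\<close> agree.

  Diagonal form: here \<open>T = {}\<close>, the expansion is orthogonal, and the second moment is
  \<open>\<Sum>\<^sub>K v ^ card K * (cmod \<beta>\<^sub>K)\<^sup>2\<close> with \<open>\<beta>\<^sub>K\<close> the sum of \<open>b\<close> over the \<open>d\<close>-sets containing \<open>K\<close>.
  Because \<open>b\<close> has sum zero, the contribution of level \<open>k + 1\<close> is smaller by a factor
  \<open>(k + 1) / d\<close> than what general coefficients would allow (\<open>sum_superset_sums_sq_le\<close>). This is a spectral gap estimate
  for inclusion matrices, proved by induction on the level from the case of single points. Summing the
  levels gives \<open>v * d / n * exp (v * d\<^sup>2 / n)\<close> up to the norm of \<open>A\<close>.

  Off-diagonal form: at most \<open>2 ^ (card T + card K)\<close> terms share a support, so Cauchy-Schwarz costs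
  this factor (\<open>integral_norm_sum_sq_le\<close>). A second application of Cauchy-Schwarz, to the sum of the
  \<open>A\<^sub>I\<^sub>J\<close> that share a term \<open>chaos T K\<close>, costs the number of these pairs. The accumulated weight of
  a pair with \<open>card (I - J) = m\<close> is \<open>off_weight\<close> (\<open>off_diagonal_part\<close>). For \<open>16 * d \<le> n\<close> it is at
  most \<open>8 * ((n - 2) choose (d - 1)) * exp (2 * v * d\<^sup>2 / (n - d))\<close> (\<open>off_weight_le\<close>), which is
  \<open>p * eps_off v d n\<close>; the constant \<open>8\<close> is \<open>2\<^sup>2\<close> from the block size times \<open>2 choose 1\<close> from the
  pairs at \<open>m = 1\<close>.

  As \<open>d\<^sup>2 / n\<close> converges, \<open>d / n\<close> tends to \<open>0\<close>, so \<open>16 * d \<le> n\<close> holds for large \<open>n\<close> and both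
  bounds tend to \<open>0\<close>.\<close>

section \<open>Sums over subsets of a given size\<close>

lemma sum_Pow_eq_sum_nsets:
  assumes "finite V"
  shows "(\<Sum>K\<in>Pow V. f K) = (\<Sum>k\<le>card V. \<Sum>K\<in>nsets V k. f K)"
proof -
  have "(\<Sum>k\<le>card V. \<Sum>K\<in>{K\<in>Pow V. card K = k}. f K) = (\<Sum>K\<in>Pow V. f K)"
    by (rule sum.group) (use assms card_mono in \<open>auto simp: finite_subset\<close>)
  moreover have "{K\<in>Pow V. card K = k} = nsets V k" for k
    using assms by (auto simp: nsets_def finite_subset)
  ultimately show ?thesis by simp
qed

lemma sum_supersets_nsets:
  assumes "finite V" "L \<subseteq> V" "card L \<le> d"
  shows "(\<Sum>I | I \<in> nsets V d \<and> L \<subseteq> I. f I) = (\<Sum>J\<in>nsets (V - L) (d - card L). f (J \<union> L))"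
proof -
  have fL: "finite L" using assms finite_subset by auto
  have card: "card (J \<union> L) = d" if "J \<subseteq> V - L" "card J = d - card L" for J
  proof -
    have "finite J" "J \<inter> L = {}" using that assms(1) by (auto intro: finite_subset)
    then show ?thesis using that fL assms(3) by (simp add: card_Un_disjoint)
  qed
  show ?thesis
    by (rule sum.reindex_bij_witness[where i = "\<lambda>J. J \<union> L" and j = "\<lambda>I. I - L"])
       (use assms fL card in \<open>auto simp: nsets_def card_Diff_subset Un_absorb2\<close>)
qed

lemma card_supersets_nsets:
  assumes "finite V" "L \<subseteq> V" "card L \<le> d"
  shows "card {I \<in> nsets V d. L \<subseteq> I} = (card V - card L) choose (d - card L)"
  using sum_supersets_nsets[OF assms, of "\<lambda>_. 1::nat"] assms
  by (simp add: card_Diff_subset finite_subset)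

text \<open>  Both sides count the pairs \<open>i \<in> K\<close>, listed once by \<open>K\<close> and once by \<open>L = K - {i}\<close>.\<close>

lemma sum_nsets_Suc_elements:
  fixes g :: "'a set \<Rightarrow> real"
  assumes "finite V"
  shows "real (Suc k) * (\<Sum>K\<in>nsets V (Suc k). g K) = (\<Sum>L\<in>nsets V k. \<Sum>i\<in>V - L. g (insert i L))"
proof -
  have "real (Suc k) * (\<Sum>K\<in>nsets V (Suc k). g K) = (\<Sum>K\<in>nsets V (Suc k). \<Sum>i\<in>K. g K)"
    by (simp add: sum_distrib_left nsets_def)
  also have "\<dots> = (\<Sum>(K, i)\<in>Sigma (nsets V (Suc k)) (\<lambda>K. K). g K)"
    by (rule sum.Sigma) (use assms in \<open>auto simp: finite_imp_finite_nsets nsets_def\<close>)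
  also have "\<dots> = (\<Sum>(L, i)\<in>Sigma (nsets V k) (\<lambda>L. V - L). g (insert i L))"
    by (rule sum.reindex_bij_witness[where i = "\<lambda>(L, i). (insert i L, i)" and j = "\<lambda>(K, i). (K - {i}, i)"])
       (auto simp: nsets_def insert_absorb)
  also have "\<dots> = (\<Sum>L\<in>nsets V k. \<Sum>i\<in>V - L. g (insert i L))"
    by (rule sum.Sigma[symmetric]) (use assms in \<open>auto simp: finite_imp_finite_nsets\<close>)
  finally show ?thesis .
qed

section \<open>The first inclusion matrix on mean-zero vectors\<close>

lemma sum_norm_sq_diff_mean:
  fixes y :: "'i \<Rightarrow> complex"
  assumes "finite S"
  shows "(\<Sum>i\<in>S. (cmod (y i - (\<Sum>j\<in>S. y j) / of_nat (card S)))\<^sup>2)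
         = (\<Sum>i\<in>S. (cmod (y i))\<^sup>2) - (cmod (\<Sum>j\<in>S. y j))\<^sup>2 / real (card S)"
proof (cases "S = {}")
  case False
  define s where "s = (\<Sum>j\<in>S. y j)"
  define n where "n = real (card S)"
  have n: "n > 0" using False assms by (simp add: n_def card_gt_0_iff)
  have "(cmod (y i - s / of_nat (card S)))\<^sup>2
        = (cmod (y i))\<^sup>2 - 2 * (Re s / n * Re (y i)) - 2 * (Im s / n * Im (y i)) + (cmod s)\<^sup>2 / n\<^sup>2" for i
    using n unfolding cmod_power2 n_def[symmetric]
    by (simp add: n_def[symmetric] power2_eq_square field_simps)
  then have "(\<Sum>i\<in>S. (cmod (y i - s / of_nat (card S)))\<^sup>2)
     = (\<Sum>i\<in>S. (cmod (y i))\<^sup>2) - 2 * (Re s / n * (\<Sum>i\<in>S. Re (y i))) - 2 * (Im s / n * (\<Sum>i\<in>S. Im (y i)))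
        + n * ((cmod s)\<^sup>2 / n\<^sup>2)"
    by (simp add: sum.distrib sum_subtractf sum_distrib_left n_def)
  also have "\<dots> = (\<Sum>i\<in>S. (cmod (y i))\<^sup>2) - (cmod s)\<^sup>2 / n"
    using n unfolding cmod_power2 Re_sum[symmetric] Im_sum[symmetric] s_def[symmetric]
    by (simp add: field_simps power2_eq_square)
  finally show ?thesis by (simp add: s_def n_def)
qed simp

lemma norm_sum_sq_eq_double_sum:
  fixes y :: "'i \<Rightarrow> complex"
  shows "(cmod (\<Sum>i\<in>S. y i))\<^sup>2 = (\<Sum>i\<in>S. \<Sum>j\<in>S. Re (y i * cnj (y j)))"
proof -
  have "complex_of_real ((cmod (\<Sum>i\<in>S. y i))\<^sup>2) = (\<Sum>i\<in>S. y i) * cnj (\<Sum>j\<in>S. y j)"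
    by (simp add: complex_norm_square del: of_real_power)
  also have "\<dots> = (\<Sum>i\<in>S. \<Sum>j\<in>S. y i * cnj (y j))"
    by (simp add: sum_product)
  finally have "Re (complex_of_real ((cmod (\<Sum>i\<in>S. y i))\<^sup>2)) = Re (\<Sum>i\<in>S. \<Sum>j\<in>S. y i * cnj (y j))"
    by (rule arg_cong)
  then show ?thesis by simp
qed

text \<open>  The Gram matrix of the incidence of points in \<open>d\<close>-sets is \<open>(N1 - N2) Id + N2 J\<close>, where \<open>J\<close> is
  the all-ones matrix, \<open>N1\<close> counts the sets through one point and \<open>N2\<close> those through two. On
  mean-zero vectors \<open>J\<close> vanishes, and only an eigenvalue at most \<open>N1\<close> is left.\<close>

lemma sum_nsets_norm_sum_sq_le:
  fixes y :: "'i \<Rightarrow> complex"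
  assumes "finite V" "1 \<le> d" and y0: "(\<Sum>i\<in>V. y i) = 0"
  shows "(\<Sum>I\<in>nsets V d. (cmod (\<Sum>i\<in>I. y i))\<^sup>2)
         \<le> real ((card V - 1) choose (d - 1)) * (\<Sum>i\<in>V. (cmod (y i))\<^sup>2)"
proof -
  define N1 N2 where "N1 = (card V - 1) choose (d - 1)"
    and "N2 = (if 2 \<le> d then (card V - 2) choose (d - 2) else 0)"
  define c where "c i j = card {I \<in> nsets V d. {i, j} \<subseteq> I}" for i j
  have fin: "finite (nsets V d)" using assms(1) by (rule finite_imp_finite_nsets)
  have c_diag: "c i i = N1" if "i \<in> V" for i
    using card_supersets_nsets[of V "{i}" d] assms that by (simp add: c_def N1_def)
  have c_off: "c i j = N2" if "i \<in> V" "j \<in> V" "i \<noteq> j" for i j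
  proof (cases "2 \<le> d")
    case True
    then show ?thesis
      using card_supersets_nsets[of V "{i, j}" d] assms(1) that by (simp add: c_def N2_def numeral_2_eq_2)
  next
    case False
    then have "\<not> {i, j} \<subseteq> I" if "I \<in> nsets V d" for I
      using card_mono[of I "{i, j}"] that \<open>i \<noteq> j\<close> by (auto simp: nsets_def)
    then have "{I \<in> nsets V d. {i, j} \<subseteq> I} = {}" by auto
    with False show ?thesis unfolding c_def N2_def by (metis card.empty)
  qed
  have "(\<Sum>I\<in>nsets V d. (cmod (\<Sum>i\<in>I. y i))\<^sup>2)
      = (\<Sum>I\<in>nsets V d. \<Sum>i\<in>V. \<Sum>j\<in>V. if {i, j} \<subseteq> I then Re (y i * cnj (y j)) else 0)"
  proof (rule sum.cong[OF refl])
    fix I assume "I \<in> nsets V d"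
    then have I: "I \<subseteq> V" by (simp add: nsets_def)
    have "(cmod (\<Sum>i\<in>I. y i))\<^sup>2
        = (\<Sum>i\<in>V. if i \<in> I then \<Sum>j\<in>V. if j \<in> I then Re (y i * cnj (y j)) else 0 else 0)"
      using I assms(1) by (simp add: norm_sum_sq_eq_double_sum sum.inter_restrict[symmetric] Int_absorb1)
    also have "\<dots> = (\<Sum>i\<in>V. \<Sum>j\<in>V. if {i, j} \<subseteq> I then Re (y i * cnj (y j)) else 0)"
      by (intro sum.cong) auto
    finally show "(cmod (\<Sum>i\<in>I. y i))\<^sup>2 = \<dots>" .
  qed
  also have "\<dots> = (\<Sum>i\<in>V. \<Sum>j\<in>V. \<Sum>I\<in>nsets V d. if {i, j} \<subseteq> I then Re (y i * cnj (y j)) else 0)"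
    by (subst sum.swap, intro sum.cong refl, rule sum.swap)
  also have "\<dots> = (\<Sum>i\<in>V. \<Sum>j\<in>V. real (c i j) * Re (y i * cnj (y j)))"
    by (simp add: c_def sum.inter_filter[OF fin, symmetric])
  also have "\<dots> = (\<Sum>i\<in>V. \<Sum>j\<in>V. (if i = j then (real N1 - real N2) * Re (y i * cnj (y j)) else 0)
                                  + real N2 * Re (y i * cnj (y j)))"
  proof (intro sum.cong refl)
    fix i j assume "i \<in> V" "j \<in> V"
    then show "real (c i j) * Re (y i * cnj (y j))
        = (if i = j then (real N1 - real N2) * Re (y i * cnj (y j)) else 0) + real N2 * Re (y i * cnj (y j))"
      by (cases "i = j") (simp_all add: c_diag c_off left_diff_distrib)
  qed
  also have "\<dots> = (\<Sum>i\<in>V. (real N1 - real N2) * Re (y i * cnj (y i)))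
                   + real N2 * (cmod (\<Sum>i\<in>V. y i))\<^sup>2"
    using assms(1) unfolding norm_sum_sq_eq_double_sum sum.distrib sum_distrib_left by simp
  also have "\<dots> = (real N1 - real N2) * (\<Sum>i\<in>V. (cmod (y i))\<^sup>2)"
    unfolding cmod_power2 y0 by (simp add: sum_distrib_left power2_eq_square)
  also have "\<dots> \<le> real N1 * (\<Sum>i\<in>V. (cmod (y i))\<^sup>2)"
    by (intro mult_right_mono) (auto intro: sum_nonneg)
  finally show ?thesis by (simp add: N1_def)
qed

text \<open>  The transpose of the previous estimate. The vector of point sums \<open>y\<close> is split into its mean,
  which only sees the total of \<open>b\<close>, and its mean-zero part \<open>y'\<close>. The squared norm \<open>E\<close> of \<open>y'\<close>
  equals the inner product of \<open>b\<close> with the sums of \<open>y'\<close> over \<open>d\<close>-sets, so Cauchy-Schwarz and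
  \<open>sum_nsets_norm_sum_sq_le\<close> give \<open>E\<^sup>2 \<le> \<alpha> * E * B\<close>.\<close>

lemma sum_vertex_sums_sq_le:
  fixes b :: "'i set \<Rightarrow> complex"
  assumes V: "finite V" "V \<noteq> {}" and d: "1 \<le> d"
  shows "(\<Sum>i\<in>V. (cmod (\<Sum>I | I \<in> nsets V d \<and> i \<in> I. b I))\<^sup>2)
    \<le> real ((card V - 1) choose (d - 1)) * (\<Sum>I\<in>nsets V d. (cmod (b I))\<^sup>2)
      + (real d)\<^sup>2 / real (card V) * (cmod (\<Sum>I\<in>nsets V d. b I))\<^sup>2"
proof -
  define y where "y i = (\<Sum>I | I \<in> nsets V d \<and> i \<in> I. b I)" for i
  define s where "s = (\<Sum>i\<in>V. y i)"
  define n where "n = card V"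
  define y' where "y' i = y i - s / of_nat n" for i
  define \<alpha> where "\<alpha> = real ((card V - 1) choose (d - 1))"
  define B where "B = (\<Sum>I\<in>nsets V d. (cmod (b I))\<^sup>2)"
  define E where "E = (\<Sum>i\<in>V. (cmod (y' i))\<^sup>2)"
  have fin: "finite (nsets V d)" using V(1) by (rule finite_imp_finite_nsets)
  have n: "n > 0" using V by (simp add: n_def card_gt_0_iff)
  have y_if: "y i = (\<Sum>I\<in>nsets V d. if i \<in> I then b I else 0)" for i
    using fin by (simp add: y_def sum.inter_filter)
  have s: "s = of_nat d * (\<Sum>I\<in>nsets V d. b I)"
  proof -
    have "s = (\<Sum>I\<in>nsets V d. \<Sum>i\<in>V. if i \<in> I then b I else 0)"
      unfolding s_def y_if by (rule sum.swap)
    also have "\<dots> = (\<Sum>I\<in>nsets V d. of_nat d * b I)"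
      using V(1) by (intro sum.cong refl) (auto simp: nsets_def sum.inter_restrict[symmetric] Int_absorb1)
    finally show ?thesis by (simp add: sum_distrib_left)
  qed
  have y'0: "(\<Sum>i\<in>V. y' i) = 0"
    using n by (simp add: y'_def sum_subtractf s_def[symmetric] n_def)
  have E_nonneg: "E \<ge> 0" and B_nonneg: "B \<ge> 0" by (auto simp: E_def B_def intro: sum_nonneg)
  have y'_mult: "c * y' i = c * y i - c * (s / of_nat n)" for c i
    by (simp add: y'_def right_diff_distrib)
  have "complex_of_real E = (\<Sum>i\<in>V. cnj (y' i) * y' i)"
    by (simp add: E_def complex_norm_square mult.commute del: of_real_power)
  also have "\<dots> = (\<Sum>i\<in>V. cnj (y' i) * y i) - (\<Sum>i\<in>V. cnj (y' i)) * (s / of_nat n)"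
    by (simp add: y'_mult sum_subtractf sum_distrib_right sum_divide_distrib)
  also have "(\<Sum>i\<in>V. cnj (y' i)) = 0"
    using y'0 by (metis cnj_sum complex_cnj_zero)
  also have "(\<Sum>i\<in>V. cnj (y' i) * y i) = (\<Sum>I\<in>nsets V d. \<Sum>i\<in>V. if i \<in> I then cnj (y' i) * b I else 0)"
    unfolding y_if by (subst sum.swap) (simp add: sum_distrib_left if_distrib cong: if_cong)
  also have "\<dots> = (\<Sum>I\<in>nsets V d. cnj (\<Sum>i\<in>I. y' i) * b I)"
    using V(1) by (intro sum.cong refl)
      (auto simp: nsets_def sum.inter_restrict[symmetric] Int_absorb1 sum_distrib_right)
  finally have "E = cmod (\<Sum>I\<in>nsets V d. cnj (\<Sum>i\<in>I. y' i) * b I)"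
    using E_nonneg by (metis abs_of_nonneg diff_zero mult_zero_left norm_of_real)
  also have "\<dots> \<le> (\<Sum>I\<in>nsets V d. cmod (\<Sum>i\<in>I. y' i) * cmod (b I))"
    by (rule order_trans[OF norm_sum]) (simp add: norm_mult del: cnj_sum)
  finally have "E\<^sup>2 \<le> (\<Sum>I\<in>nsets V d. cmod (\<Sum>i\<in>I. y' i) * cmod (b I))\<^sup>2"
    using E_nonneg by (rule power_mono)
  also have "\<dots> \<le> (\<Sum>I\<in>nsets V d. (cmod (\<Sum>i\<in>I. y' i))\<^sup>2) * B"
    unfolding B_def by (rule Cauchy_Schwarz_ineq_sum)
  also have "\<dots> \<le> (\<alpha> * E) * B"
    unfolding \<alpha>_def E_def
    by (intro mult_right_mono sum_nsets_norm_sum_sq_le V d y'0 B_nonneg)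
  finally have "E * E \<le> E * (\<alpha> * B)" by (simp add: power2_eq_square algebra_simps)
  then have "E \<le> \<alpha> * B"
    using E_nonneg B_nonneg by (cases "E = 0") (auto simp: \<alpha>_def mult_le_cancel_left)
  moreover have "E = (\<Sum>i\<in>V. (cmod (y i))\<^sup>2) - (cmod s)\<^sup>2 / real n"
    unfolding E_def y'_def s_def n_def by (rule sum_norm_sq_diff_mean[OF V(1)])
  moreover have "(cmod s)\<^sup>2 / real n = (real d)\<^sup>2 / real n * (cmod (\<Sum>I\<in>nsets V d. b I))\<^sup>2"
    by (simp add: s norm_mult power_mult_distrib)
  ultimately have "(\<Sum>i\<in>V. (cmod (y i))\<^sup>2)
      \<le> \<alpha> * B + (real d)\<^sup>2 / real n * (cmod (\<Sum>I\<in>nsets V d. b I))\<^sup>2"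
    by linarith
  then show ?thesis unfolding y_def \<alpha>_def B_def n_def .
qed

section \<open>Inclusion matrices of higher order on mean-zero vectors\<close>

text \<open>  \<open>((n - k) choose (d - k)) / (n choose d)\<close> is the product of the \<open>k\<close> ratios
  \<open>(d - j) / (n - j)\<close>, each of which is at most \<open>d / n\<close>.\<close>

lemma choose_diff_le:
  assumes "k \<le> d" "d \<le> n"
  shows "real ((n - k) choose (d - k)) \<le> (real d / real n) ^ k * real (n choose d)"
  using assms(1)
proof (induction k)
  case (Suc k)
  then have k: "k < d" "k < n" using assms(2) by auto
  have "(d - k) * ((n - k) choose (d - k)) = (n - k) * ((n - Suc k) choose (d - Suc k))"
    using binomial_absorption[of "d - Suc k" "n - k"] k by (simp add: Suc_diff_Suc)
  then have "real (d - k) * real ((n - k) choose (d - k)) = real (n - k) * real ((n - Suc k) choose (d - Suc k))"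
    by (metis of_nat_mult)
  then have "real ((n - Suc k) choose (d - Suc k)) = real (d - k) / real (n - k) * real ((n - k) choose (d - k))"
    using k by (simp add: field_simps)
  also have "\<dots> \<le> real d / real n * ((real d / real n) ^ k * real (n choose d))"
  proof (intro mult_mono)
    have "real k * real d \<le> real k * real n" using assms(2) by (intro mult_left_mono) auto
    then show "real (d - k) / real (n - k) \<le> real d / real n"
      using k by (simp add: field_simps of_nat_diff)
  qed (use Suc in auto)
  finally show ?case by simp
qed simp

lemma choose_le_pow_div_fact: "real (n choose k) \<le> real n ^ k / fact k"
proof -
  have "real ((n choose k) * fact k) \<le> real (n ^ k)"
    using binomial_fact_pow of_nat_le_iff by blast
  then show ?thesis by (simp add: field_simps)
qed

text \<open>  The estimate behind the diagonal term. A crude bound on the row sums of the Gram matrix would give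
  \<open>(d\<^sup>2 / n) ^ Suc k / fact (Suc k)\<close> in place of the last factors; it is the condition \<open>b0\<close> that turns one of the factors \<open>d\<^sup>2 / n\<close> into
  \<open>d / n\<close>, and only \<open>d / n\<close> tends to zero.

  The proof is an induction on \<open>k\<close> through links: for a \<open>k\<close>-set \<open>L\<close>, the \<open>d\<close>-sets containing \<open>L\<close>
  correspond to the \<open>(d - k)\<close>-subsets of \<open>V - L\<close>, where \<open>sum_vertex_sums_sq_le\<close> applies with total
  \<open>\<beta> L\<close>. Summed over all \<open>L\<close>, the squares of these totals form the sum \<open>S k\<close> of the previous
  level. With \<open>C = p * B * d / n\<close> the resulting recursion \<open>(k + 1) S (k + 1) \<le> C \<theta> ^ k / k! + \<theta> S k\<close> starts from
  \<open>S 0 = 0\<close>.\<close>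

lemma sum_superset_sums_sq_le:
  fixes b :: "'i set \<Rightarrow> complex" and d k :: nat
  assumes V: "finite V" and d: "1 \<le> d" "d \<le> card V" and b0: "(\<Sum>I\<in>nsets V d. b I) = 0"
  shows "(\<Sum>K\<in>nsets V (Suc k). (cmod (\<Sum>I | I \<in> nsets V d \<and> K \<subseteq> I. b I))\<^sup>2)
    \<le> real (card V choose d) * (\<Sum>I\<in>nsets V d. (cmod (b I))\<^sup>2)
        * (real d / real (card V)) * ((real d)\<^sup>2 / real (card V)) ^ k / fact k"
proof -
  define n where "n = card V"
  define p where "p = real (card V choose d)"
  define B where "B = (\<Sum>I\<in>nsets V d. (cmod (b I))\<^sup>2)"
  define \<theta> where "\<theta> = (real d)\<^sup>2 / real n"
  define \<beta> where "\<beta> K = (\<Sum>I | I \<in> nsets V d \<and> K \<subseteq> I. b I)" for K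
  define S where "S k = (\<Sum>K\<in>nsets V k. (cmod (\<beta> K))\<^sup>2)" for k
  have n: "n > 0" "d \<le> n" using d by (auto simp: n_def)
  have fin: "finite (nsets V k)" for k using V by (rule finite_imp_finite_nsets)
  have B_nonneg: "B \<ge> 0" by (auto simp: B_def intro: sum_nonneg)
  have p_nonneg: "p \<ge> 0" by (simp add: p_def)
  have \<theta>_nonneg: "\<theta> \<ge> 0" by (simp add: \<theta>_def)
  have S0: "S 0 = 0" using b0 by (simp add: S_def \<beta>_def)
  \<comment> \<open>Beyond level \<open>d\<close> there are no supersets, so the recursion is only needed for \<open>k < d\<close>.\<close>
  have S_large: "S (Suc k) = 0" if "k \<ge> d" for k
  proof -
    have "\<not> K \<subseteq> I" if "K \<in> nsets V (Suc k)" "I \<in> nsets V d" for K I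
      using \<open>k \<ge> d\<close> that card_mono[of I K] by (auto simp: nsets_def)
    then have "{I \<in> nsets V d. K \<subseteq> I} = {}" if "K \<in> nsets V (Suc k)" for K
      using that by blast
    then show ?thesis by (auto simp: S_def \<beta>_def intro!: sum.neutral)
  qed
  have link: "(\<Sum>i\<in>V - L. (cmod (\<beta> (insert i L)))\<^sup>2)
      \<le> (real d / real n) ^ Suc k * p * (\<Sum>I | I \<in> nsets V d \<and> L \<subseteq> I. (cmod (b I))\<^sup>2)
        + \<theta> * (cmod (\<beta> L))\<^sup>2" if L: "L \<in> nsets V k" and k: "k < d" for L k
  proof -
    define b' where "b' J = b (J \<union> L)" for J
    have L': "L \<subseteq> V" "card L = k" "finite L" using L by (auto simp: nsets_def)
    have card: "card (V - L) = n - k" using L' by (simp add: card_Diff_subset n_def)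
    have ne: "V - L \<noteq> {}" using card k n by (metis card.empty diff_is_0_eq' less_le_not_le less_le_trans zero_less_diff)
    have \<beta>': "\<beta> (insert i L) = (\<Sum>J | J \<in> nsets (V - L) (d - k) \<and> i \<in> J. b' J)" if "i \<in> V - L" for i
    proof -
      have "\<beta> (insert i L) = (\<Sum>I | I \<in> nsets V d \<and> L \<subseteq> I. if i \<in> I then b I else 0)"
        unfolding \<beta>_def using fin by (subst sum.inter_filter[symmetric]) (auto intro!: sum.cong)
      also have "\<dots> = (\<Sum>J\<in>nsets (V - L) (d - k). if i \<in> J then b' J else 0)"
        using sum_supersets_nsets[OF V L'(1), of d "\<lambda>I. if i \<in> I then b I else 0"] L' k that
        by (simp add: b'_def cong: if_cong)
      finally show ?thesis
        using V by (simp add: finite_imp_finite_nsets sum.inter_filter)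
    qed
    have "(\<Sum>i\<in>V - L. (cmod (\<beta> (insert i L)))\<^sup>2)
        = (\<Sum>i\<in>V - L. (cmod (\<Sum>J | J \<in> nsets (V - L) (d - k) \<and> i \<in> J. b' J))\<^sup>2)"
      by (intro sum.cong refl) (simp add: \<beta>')
    also have "\<dots> \<le> real ((card (V - L) - 1) choose (d - k - 1)) * (\<Sum>J\<in>nsets (V - L) (d - k). (cmod (b' J))\<^sup>2)
         + (real (d - k))\<^sup>2 / real (card (V - L)) * (cmod (\<Sum>J\<in>nsets (V - L) (d - k). b' J))\<^sup>2"
      by (rule sum_vertex_sums_sq_le) (use V k n ne in auto)
    also have "(\<Sum>J\<in>nsets (V - L) (d - k). (cmod (b' J))\<^sup>2) = (\<Sum>I | I \<in> nsets V d \<and> L \<subseteq> I. (cmod (b I))\<^sup>2)"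
      using sum_supersets_nsets[OF V L'(1), of d "\<lambda>I. (cmod (b I))\<^sup>2"] L' k by (simp add: b'_def)
    also have "(\<Sum>J\<in>nsets (V - L) (d - k). b' J) = \<beta> L"
      using sum_supersets_nsets[OF V L'(1), of d b] L' k by (simp add: b'_def \<beta>_def)
    also have "real ((card (V - L) - 1) choose (d - k - 1)) * (\<Sum>I | I \<in> nsets V d \<and> L \<subseteq> I. (cmod (b I))\<^sup>2)
         + (real (d - k))\<^sup>2 / real (card (V - L)) * (cmod (\<beta> L))\<^sup>2
      \<le> (real d / real n) ^ Suc k * p * (\<Sum>I | I \<in> nsets V d \<and> L \<subseteq> I. (cmod (b I))\<^sup>2)
         + \<theta> * (cmod (\<beta> L))\<^sup>2"
    proof (intro add_mono mult_right_mono)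
      show "real ((card (V - L) - 1) choose (d - k - 1)) \<le> (real d / real n) ^ Suc k * p"
        using choose_diff_le[of "Suc k" d n] k n by (simp add: card p_def n_def)
      have "real k * real d \<le> real k * real n" using n(2) by (intro mult_left_mono) auto
      then have "real (d - k) / real (n - k) \<le> real d / real n"
        using k n by (simp add: field_simps of_nat_diff)
      then have "real (d - k) * (real (d - k) / real (n - k)) \<le> real d * (real d / real n)"
        by (intro mult_mono) auto
      then show "(real (d - k))\<^sup>2 / real (card (V - L)) \<le> \<theta>"
        by (simp add: card \<theta>_def power2_eq_square)
    qed (auto intro: sum_nonneg)
    finally show ?thesis .
  qed
  have pairs: "(\<Sum>L\<in>nsets V k. \<Sum>I | I \<in> nsets V d \<and> L \<subseteq> I. (cmod (b I))\<^sup>2) = real (d choose k) * B" for k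
  proof -
    have "(\<Sum>L\<in>nsets V k. \<Sum>I | I \<in> nsets V d \<and> L \<subseteq> I. (cmod (b I))\<^sup>2)
        = (\<Sum>I\<in>nsets V d. \<Sum>L | L \<in> nsets V k \<and> L \<subseteq> I. (cmod (b I))\<^sup>2)"
      by (rule sum.swap_restrict[OF fin fin])
    also have "\<dots> = (\<Sum>I\<in>nsets V d. real (d choose k) * (cmod (b I))\<^sup>2)"
    proof (rule sum.cong[OF refl])
      fix I assume I: "I \<in> nsets V d"
      then have "{L \<in> nsets V k. L \<subseteq> I} = nsets I k" by (auto simp: nsets_def)
      with I show "(\<Sum>L | L \<in> nsets V k \<and> L \<subseteq> I. (cmod (b I))\<^sup>2) = real (d choose k) * (cmod (b I))\<^sup>2"
        by (simp add: nsets_def[of V d])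
    qed
    finally show ?thesis by (simp add: B_def sum_distrib_left)
  qed
  have rec: "real (Suc k) * S (Suc k) \<le> p * B * (real d / real n) * \<theta> ^ k / fact k + \<theta> * S k" if k: "k < d" for k
  proof -
    have "real (Suc k) * S (Suc k) = (\<Sum>L\<in>nsets V k. \<Sum>i\<in>V - L. (cmod (\<beta> (insert i L)))\<^sup>2)"
      unfolding S_def by (rule sum_nsets_Suc_elements[OF V])
    also have "\<dots> \<le> (\<Sum>L\<in>nsets V k. (real d / real n) ^ Suc k * p * (\<Sum>I | I \<in> nsets V d \<and> L \<subseteq> I. (cmod (b I))\<^sup>2)
        + \<theta> * (cmod (\<beta> L))\<^sup>2)"
      by (intro sum_mono link k)
    also have "\<dots> = (real d / real n) ^ Suc k * p * (real (d choose k) * B) + \<theta> * S k"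
      unfolding sum.distrib sum_distrib_left[symmetric] pairs S_def by (rule refl)
    also have "\<dots> \<le> (real d / real n) ^ Suc k * p * (real d ^ k / fact k * B) + \<theta> * S k"
      by (intro add_right_mono mult_left_mono mult_right_mono choose_le_pow_div_fact)
         (use B_nonneg p_nonneg in auto)
    also have "(real d / real n) ^ Suc k * p * (real d ^ k / fact k * B) = p * B * (real d / real n) * \<theta> ^ k / fact k"
      by (simp add: \<theta>_def power2_eq_square power_divide power_mult_distrib)
    finally show ?thesis .
  qed
  have "S (Suc k) \<le> p * B * (real d / real n) * \<theta> ^ k / fact k" for k
  proof (induction k)
    case 0
    show ?case using rec[of 0] d S0 by simp
  next
    case (Suc k)
    show ?case
    proof (cases "Suc k < d")
      case True
      define C where "C = p * B * (real d / real n)"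
      have "real (Suc (Suc k)) * S (Suc (Suc k)) \<le> C * \<theta> ^ Suc k / fact (Suc k) + \<theta> * S (Suc k)"
        using rec[OF True] by (simp add: C_def)
      also have "\<dots> \<le> C * \<theta> ^ Suc k / fact (Suc k) + \<theta> * (C * \<theta> ^ k / fact k)"
        using Suc \<theta>_nonneg by (intro add_left_mono mult_left_mono) (auto simp: C_def)
      also have "\<theta> * (C * \<theta> ^ k / fact k) = real (Suc k) * (C * \<theta> ^ Suc k / fact (Suc k))"
        by (simp del: of_nat_Suc)
      also have "C * \<theta> ^ Suc k / fact (Suc k) + \<dots> = real (Suc (Suc k)) * (C * \<theta> ^ Suc k / fact (Suc k))"
        unfolding of_nat_Suc[of "Suc k"] by (simp only: distrib_right mult_1 add.commute)
      finally show ?thesis unfolding C_def by (subst (asm) mult_le_cancel_left_pos) auto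
    next
      case False
      then show ?thesis using S_large[of "Suc k"] B_nonneg p_nonneg \<theta>_nonneg by simp
    qed
  qed
  then show ?thesis by (simp add: S_def \<beta>_def p_def B_def \<theta>_def n_def)
qed

lemma weighted_superset_sums_sq_le:
  fixes b :: "'i set \<Rightarrow> complex" and v :: real
  assumes V: "finite V" and d: "1 \<le> d" "d \<le> card V" and b0: "(\<Sum>I\<in>nsets V d. b I) = 0"
    and v: "0 \<le> v"
  shows "(\<Sum>K\<in>Pow V. v ^ card K * (cmod (\<Sum>I | I \<in> nsets V d \<and> K \<subseteq> I. b I))\<^sup>2)
    \<le> real (card V choose d) * (\<Sum>I\<in>nsets V d. (cmod (b I))\<^sup>2)
        * (v * real d / real (card V) * exp (v * (real d)\<^sup>2 / real (card V)))"
proof -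
  define n where "n = card V"
  define \<theta> where "\<theta> = (real d)\<^sup>2 / real n"
  define C where "C = real (card V choose d) * (\<Sum>I\<in>nsets V d. (cmod (b I))\<^sup>2) * (real d / real n)"
  define \<beta> where "\<beta> K = (\<Sum>I | I \<in> nsets V d \<and> K \<subseteq> I. b I)" for K
  have C_nonneg: "C \<ge> 0" by (auto simp: C_def intro!: mult_nonneg_nonneg divide_nonneg_nonneg sum_nonneg)
  have n: "n > 0" using d by (simp add: n_def)
  have "(\<Sum>K\<in>Pow V. v ^ card K * (cmod (\<beta> K))\<^sup>2)
      = (\<Sum>k\<le>n. \<Sum>K\<in>nsets V k. v ^ card K * (cmod (\<beta> K))\<^sup>2)"
    unfolding n_def by (rule sum_Pow_eq_sum_nsets[OF V])
  also have "\<dots> = (\<Sum>k\<le>n. v ^ k * (\<Sum>K\<in>nsets V k. (cmod (\<beta> K))\<^sup>2))"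
    by (simp add: sum_distrib_left nsets_def)
  also have "\<dots> = (\<Sum>k<n. v ^ Suc k * (\<Sum>K\<in>nsets V (Suc k). (cmod (\<beta> K))\<^sup>2))"
    unfolding sum.atMost_shift using b0 by (simp add: \<beta>_def)
  also have "\<dots> \<le> (\<Sum>k<n. v ^ Suc k * (C * \<theta> ^ k / fact k))"
    using sum_superset_sums_sq_le[OF V d b0] v
    by (intro sum_mono mult_left_mono) (auto simp: \<beta>_def C_def \<theta>_def n_def)
  also have "\<dots> = C * v * (\<Sum>k<n. (v * \<theta>) ^ k /\<^sub>R fact k)"
    unfolding sum_distrib_left by (intro sum.cong refl) (simp add: power_mult_distrib divide_simps)
  also have "\<dots> \<le> C * v * exp (v * \<theta>)"
    unfolding exp_def using C_nonneg v
    by (intro mult_left_mono sum_le_suminf summable_exp_generic) (auto simp: \<theta>_def)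
  finally show ?thesis by (simp add: \<beta>_def C_def \<theta>_def n_def mult_ac)
qed

section \<open>Second moments of block-orthogonal sums\<close>

text \<open>  Within a block of functions with equal \<open>s\<close>, no information on the mixed moments is used: each
  product is bounded by the mean of the two squares, at the price of the size of the block.\<close>

lemma integral_norm_sum_sq_le:
  fixes g :: "'q \<Rightarrow> 'a \<Rightarrow> real" and c :: "'q \<Rightarrow> complex" and s :: "'q \<Rightarrow> 's"
  assumes Q: "finite Q"
    and int: "\<And>q q'. q \<in> Q \<Longrightarrow> q' \<in> Q \<Longrightarrow> integrable M (\<lambda>\<omega>. g q \<omega> * g q' \<omega>)"
    and orth: "\<And>q q'. q \<in> Q \<Longrightarrow> q' \<in> Q \<Longrightarrow> s q \<noteq> s q' \<Longrightarrow> (\<integral>\<omega>. g q \<omega> * g q' \<omega> \<partial>M) = 0"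
  shows "integrable M (\<lambda>\<omega>. (cmod (\<Sum>q\<in>Q. c q * of_real (g q \<omega>)))\<^sup>2)"
    and "(\<integral>\<omega>. (cmod (\<Sum>q\<in>Q. c q * of_real (g q \<omega>)))\<^sup>2 \<partial>M)
         \<le> (\<Sum>q\<in>Q. real (card {q' \<in> Q. s q' = s q}) * ((cmod (c q))\<^sup>2 * (\<integral>\<omega>. (g q \<omega>)\<^sup>2 \<partial>M)))"
proof -
  define w where "w q = (cmod (c q))\<^sup>2 * (\<integral>\<omega>. (g q \<omega>)\<^sup>2 \<partial>M)" for q
  have expand: "(cmod (\<Sum>q\<in>Q. c q * of_real (g q \<omega>)))\<^sup>2
      = (\<Sum>q\<in>Q. \<Sum>q'\<in>Q. Re (c q * cnj (c q')) * (g q \<omega> * g q' \<omega>))" for \<omega>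
    by (simp add: norm_sum_sq_eq_double_sum algebra_simps)
  show "integrable M (\<lambda>\<omega>. (cmod (\<Sum>q\<in>Q. c q * of_real (g q \<omega>)))\<^sup>2)"
    unfolding expand by (intro Bochner_Integration.integrable_sum integrable_mult_right int)
  have "(\<integral>\<omega>. (cmod (\<Sum>q\<in>Q. c q * of_real (g q \<omega>)))\<^sup>2 \<partial>M)
      = (\<Sum>q\<in>Q. \<Sum>q'\<in>Q. \<integral>\<omega>. Re (c q * cnj (c q')) * (g q \<omega> * g q' \<omega>) \<partial>M)"
    unfolding expand
    by (subst Bochner_Integration.integral_sum, intro Bochner_Integration.integrable_sum integrable_mult_right int, assumption+)
       (intro sum.cong refl, subst Bochner_Integration.integral_sum, intro integrable_mult_right int, auto)
  also have "\<dots> \<le> (\<Sum>q\<in>Q. \<Sum>q'\<in>Q. if s q' = s q then (w q + w q') / 2 else 0)"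
  proof (intro sum_mono)
    fix q q' assume q: "q \<in> Q" "q' \<in> Q"
    show "(\<integral>\<omega>. Re (c q * cnj (c q')) * (g q \<omega> * g q' \<omega>) \<partial>M) \<le> (if s q' = s q then (w q + w q') / 2 else 0)"
    proof (cases "s q' = s q")
      case True
      have "Re (c q * cnj (c q')) * (g q \<omega> * g q' \<omega>)
          \<le> ((cmod (c q))\<^sup>2 * (g q \<omega>)\<^sup>2 + (cmod (c q'))\<^sup>2 * (g q' \<omega>)\<^sup>2) / 2" for \<omega>
      proof -
        have "0 \<le> (Re (c q) * g q \<omega> - Re (c q') * g q' \<omega>)\<^sup>2 + (Im (c q) * g q \<omega> - Im (c q') * g q' \<omega>)\<^sup>2"
          by simp
        then show ?thesis unfolding cmod_power2 by (simp add: power2_eq_square algebra_simps)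
      qed
      then have "(\<integral>\<omega>. Re (c q * cnj (c q')) * (g q \<omega> * g q' \<omega>) \<partial>M)
          \<le> (\<integral>\<omega>. ((cmod (c q))\<^sup>2 * (g q \<omega>)\<^sup>2 + (cmod (c q'))\<^sup>2 * (g q' \<omega>)\<^sup>2) / 2 \<partial>M)"
        using int[OF q] int[OF q(1) q(1)] int[OF q(2) q(2)]
        by (intro integral_mono) (auto simp: power2_eq_square)
      also have "\<dots> = (w q + w q') / 2"
        using int[OF q(1) q(1)] int[OF q(2) q(2)] by (simp add: w_def power2_eq_square)
      finally show ?thesis using True by simp
    next
      case False
      then show ?thesis using orth[OF q] by simp
    qed
  qed
  also have "\<dots> = ((\<Sum>q\<in>Q. \<Sum>q'\<in>Q. if s q' = s q then w q else 0)
                + (\<Sum>q\<in>Q. \<Sum>q'\<in>Q. if s q' = s q then w q' else 0)) / 2"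
    unfolding sum.distrib[symmetric] sum_divide_distrib by (intro sum.cong) auto
  also have "(\<Sum>q\<in>Q. \<Sum>q'\<in>Q. if s q' = s q then w q' else 0)
           = (\<Sum>q\<in>Q. \<Sum>q'\<in>Q. if s q' = s q then w q else 0)"
    by (subst sum.swap) (intro sum.cong refl, auto)
  also have "((\<Sum>q\<in>Q. \<Sum>q'\<in>Q. if s q' = s q then w q else 0)
            + (\<Sum>q\<in>Q. \<Sum>q'\<in>Q. if s q' = s q then w q else 0)) / 2
      = (\<Sum>q\<in>Q. real (card {q' \<in> Q. s q' = s q}) * w q)"
    using Q by (simp add: sum.inter_filter[symmetric])
  finally show "(\<integral>\<omega>. (cmod (\<Sum>q\<in>Q. c q * of_real (g q \<omega>)))\<^sup>2 \<partial>M)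
      \<le> (\<Sum>q\<in>Q. real (card {q' \<in> Q. s q' = s q}) * ((cmod (c q))\<^sup>2 * (\<integral>\<omega>. (g q \<omega>)\<^sup>2 \<partial>M)))"
    unfolding w_def .
qed

section \<open>Chaos expansion of products of square-free monomials\<close>

locale standardized_sample = prob_space M for M :: "'a measure" +
  fixes V :: "'i set" and Y :: "'i \<Rightarrow> 'a \<Rightarrow> real" and v :: real
  assumes finite_V: "finite V"
    and indep: "indep_vars (\<lambda>_. borel) Y V"
    and integrable_pow4: "i \<in> V \<Longrightarrow> integrable M (\<lambda>\<omega>. Y i \<omega> ^ 4)"
    and mean_zero: "i \<in> V \<Longrightarrow> (\<integral>\<omega>. Y i \<omega> \<partial>M) = 0"
    and second_moment: "i \<in> V \<Longrightarrow> (\<integral>\<omega>. (Y i \<omega>)\<^sup>2 \<partial>M) = 1"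
    and fourth_moment: "i \<in> V \<Longrightarrow> (\<integral>\<omega>. Y i \<omega> ^ 4 \<partial>M) = 1 + v"
begin

text \<open>  For disjoint \<open>T\<close> and \<open>K\<close>, \<open>chaos T K\<close> is the product of \<open>Y i\<close> over \<open>T\<close> and of the centred
  squares \<open>(Y i)\<^sup>2 - 1\<close> over \<open>K\<close> (\<open>chaos_eq_prod\<close>). Writing it as a product over all of \<open>V\<close>
  gives any two of these functions the same index set, so that independence applies to their
  product factor by factor.\<close>

definition chaos_factor :: "'i set \<Rightarrow> 'i set \<Rightarrow> 'i \<Rightarrow> real \<Rightarrow> real" where
  "chaos_factor T K i y = (if i \<in> T then y else if i \<in> K then y\<^sup>2 - 1 else 1)"

definition chaos :: "'i set \<Rightarrow> 'i set \<Rightarrow> 'a \<Rightarrow> real" where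
  "chaos T K \<omega> = (\<Prod>i\<in>V. chaos_factor T K i (Y i \<omega>))"

lemma borel_measurable_Y: "i \<in> V \<Longrightarrow> Y i \<in> borel_measurable M"
  using indep by (auto simp: indep_vars_def)

lemma integrable_sq:
  assumes "i \<in> V"
  shows "integrable M (\<lambda>\<omega>. (Y i \<omega>)\<^sup>2)"
proof (rule Bochner_Integration.integrable_bound)
  show "integrable M (\<lambda>\<omega>. 1 + Y i \<omega> ^ 4)" using integrable_pow4[OF assms] by simp
  show "(\<lambda>\<omega>. (Y i \<omega>)\<^sup>2) \<in> borel_measurable M" using borel_measurable_Y[OF assms] by measurable
  have "y\<^sup>2 \<le> 1 + y ^ 4" for y :: real
  proof -
    have "0 \<le> (y\<^sup>2 - 1)\<^sup>2 + (y\<^sup>2)\<^sup>2 + 1" by simp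
    then show ?thesis by (simp add: power2_diff)
  qed
  then show "AE \<omega> in M. norm ((Y i \<omega>)\<^sup>2) \<le> norm (1 + Y i \<omega> ^ 4)" by (intro AE_I2) (simp add: add_nonneg_nonneg)
qed

lemma integrable_chaos_factor_mult:
  assumes i: "i \<in> V"
  shows "integrable M (\<lambda>\<omega>. chaos_factor T K i (Y i \<omega>) * chaos_factor T' K' i (Y i \<omega>))"
proof (rule Bochner_Integration.integrable_bound)
  show "integrable M (\<lambda>\<omega>. 1 + 2 * (Y i \<omega>)\<^sup>2 + Y i \<omega> ^ 4)"
    using integrable_pow4[OF i] integrable_sq[OF i] by simp
  show "(\<lambda>\<omega>. chaos_factor T K i (Y i \<omega>) * chaos_factor T' K' i (Y i \<omega>)) \<in> borel_measurable M"
    using borel_measurable_Y[OF i] unfolding chaos_factor_def by measurable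
  have bound: "\<bar>chaos_factor T K i y\<bar> \<le> 1 + y\<^sup>2" for T K and y :: real
  proof -
    have "0 \<le> (y - 1)\<^sup>2 + y\<^sup>2 + 1" "0 \<le> (y + 1)\<^sup>2 + y\<^sup>2 + 1" by simp_all
    then have "\<bar>y\<bar> \<le> 1 + y\<^sup>2" by (auto simp: power2_eq_square algebra_simps abs_le_iff)
    then show ?thesis by (auto simp: chaos_factor_def abs_le_iff)
  qed
  have "\<bar>chaos_factor T K i y * chaos_factor T' K' i y\<bar> \<le> 1 + 2 * y\<^sup>2 + y ^ 4" for y
  proof -
    have "\<bar>chaos_factor T K i y * chaos_factor T' K' i y\<bar> \<le> (1 + y\<^sup>2) * (1 + y\<^sup>2)"
      unfolding abs_mult by (intro mult_mono bound) auto
    then show ?thesis by (simp add: algebra_simps power4_eq_xxxx power2_eq_square)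
  qed
  then show "AE \<omega> in M. norm (chaos_factor T K i (Y i \<omega>) * chaos_factor T' K' i (Y i \<omega>))
      \<le> norm (1 + 2 * (Y i \<omega>)\<^sup>2 + Y i \<omega> ^ 4)"
    by (intro AE_I2) (simp add: add_nonneg_nonneg)
qed

lemma integral_chaos_factor_eq_0:
  assumes "i \<in> V" "i \<in> T \<union> K"
  shows "(\<integral>\<omega>. chaos_factor T K i (Y i \<omega>) \<partial>M) = 0"
  using assms integrable_sq[OF assms(1)] mean_zero[OF assms(1)] second_moment[OF assms(1)]
  by (cases "i \<in> T") (auto simp: chaos_factor_def prob_space)

lemma integral_chaos_factor_sq:
  assumes i: "i \<in> V"
  shows "(\<integral>\<omega>. (chaos_factor T K i (Y i \<omega>))\<^sup>2 \<partial>M) = (if i \<in> T then 1 else if i \<in> K then v else 1)"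
proof -
  have "(y\<^sup>2 - 1)\<^sup>2 = y ^ 4 - 2 * y\<^sup>2 + 1" for y :: real
    by (simp add: power2_eq_square power4_eq_xxxx algebra_simps)
  then have "(\<integral>\<omega>. ((Y i \<omega>)\<^sup>2 - 1)\<^sup>2 \<partial>M) = v"
    using integrable_sq[OF i] integrable_pow4[OF i] second_moment[OF i] fourth_moment[OF i]
    by (simp add: prob_space)
  then show ?thesis
    using second_moment[OF i] by (simp add: chaos_factor_def prob_space)
qed

lemma
  shows integrable_chaos_mult: "integrable M (\<lambda>\<omega>. chaos T K \<omega> * chaos T' K' \<omega>)"
    and integral_chaos_mult: "(\<integral>\<omega>. chaos T K \<omega> * chaos T' K' \<omega> \<partial>M)
      = (\<Prod>i\<in>V. \<integral>\<omega>. chaos_factor T K i (Y i \<omega>) * chaos_factor T' K' i (Y i \<omega>) \<partial>M)"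
proof -
  let ?f = "\<lambda>i y. chaos_factor T K i y * chaos_factor T' K' i y"
  have "indep_vars (\<lambda>_. borel) (\<lambda>i \<omega>. ?f i (Y i \<omega>)) V"
    by (rule indep_vars_compose2[OF indep]) (simp add: chaos_factor_def)
  note * = finite_V this integrable_chaos_factor_mult
  show "integrable M (\<lambda>\<omega>. chaos T K \<omega> * chaos T' K' \<omega>)"
    using indep_vars_integrable[OF *] by (simp add: chaos_def prod.distrib)
  show "(\<integral>\<omega>. chaos T K \<omega> * chaos T' K' \<omega> \<partial>M)
      = (\<Prod>i\<in>V. \<integral>\<omega>. chaos_factor T K i (Y i \<omega>) * chaos_factor T' K' i (Y i \<omega>) \<partial>M)"
    using indep_vars_lebesgue_integral[OF *] by (simp add: chaos_def prod.distrib)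
qed

text \<open>  At an index lying in only one of the two supports the product of the factors is \<open>Y i\<close> or
  \<open>(Y i)\<^sup>2 - 1\<close>, which has mean zero. When the supports agree but the pairs differ, orthogonality
  can fail: \<open>Y i\<close> and \<open>(Y i)\<^sup>2 - 1\<close> are correlated if the third moment is nonzero.\<close>

lemma chaos_orthogonal:
  assumes "T \<union> K \<subseteq> V" "T' \<union> K' \<subseteq> V" "T \<union> K \<noteq> T' \<union> K'"
  shows "(\<integral>\<omega>. chaos T K \<omega> * chaos T' K' \<omega> \<partial>M) = 0"
proof -
  obtain i where i: "i \<in> V" and "(i \<in> T \<union> K) \<noteq> (i \<in> T' \<union> K')" using assms by blast
  then consider "i \<in> T \<union> K" "i \<notin> T' \<union> K'" | "i \<notin> T \<union> K" "i \<in> T' \<union> K'" by blast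
  then have "(\<integral>\<omega>. chaos_factor T K i (Y i \<omega>) * chaos_factor T' K' i (Y i \<omega>) \<partial>M) = 0"
  proof cases
    case 1
    then show ?thesis using integral_chaos_factor_eq_0[OF i 1(1)] by (simp add: chaos_factor_def[of T'])
  next
    case 2
    then show ?thesis using integral_chaos_factor_eq_0[OF i 2(2)] by (simp add: chaos_factor_def[of T])
  qed
  then show ?thesis using finite_V i by (auto simp: integral_chaos_mult)
qed

lemma integral_chaos_sq:
  assumes "T \<inter> K = {}" "K \<subseteq> V"
  shows "(\<integral>\<omega>. (chaos T K \<omega>)\<^sup>2 \<partial>M) = v ^ card K"
proof -
  have "(\<integral>\<omega>. (chaos T K \<omega>)\<^sup>2 \<partial>M) = (\<Prod>i\<in>V. if i \<in> K then v else 1)"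
    unfolding power2_eq_square integral_chaos_mult
    by (intro prod.cong refl)
       (use assms integral_chaos_factor_sq in \<open>auto simp flip: power2_eq_square\<close>)
  also have "\<dots> = v ^ card K"
    using assms(2) finite_V by (simp add: prod.inter_restrict[symmetric] Int_absorb1)
  finally show ?thesis .
qed

text \<open>  \<open>v\<close> is the variance of \<open>(Y i)\<^sup>2\<close>.\<close>

lemma v_nonneg: "V \<noteq> {} \<Longrightarrow> 0 \<le> v"
proof -
  assume "V \<noteq> {}"
  then obtain i where "i \<in> V" by blast
  then have "(\<integral>\<omega>. (chaos {} {i} \<omega>)\<^sup>2 \<partial>M) = v" by (simp add: integral_chaos_sq)
  then show ?thesis by (metis integral_nonneg_AE AE_I2 zero_le_power2)
qed

lemma chaos_eq_prod:
  assumes "T \<subseteq> V" "K \<subseteq> V" "T \<inter> K = {}"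
  shows "chaos T K \<omega> = (\<Prod>i\<in>T. Y i \<omega>) * (\<Prod>i\<in>K. (Y i \<omega>)\<^sup>2 - 1)"
proof -
  have "chaos T K \<omega> = (\<Prod>i\<in>V. (if i \<in> T then Y i \<omega> else 1) * (if i \<in> K then (Y i \<omega>)\<^sup>2 - 1 else 1))"
    unfolding chaos_def by (intro prod.cong refl) (use assms(3) in \<open>auto simp: chaos_factor_def\<close>)
  then show ?thesis
    using assms finite_V by (simp add: prod.distrib prod.inter_restrict[symmetric] Int_absorb1)
qed

text \<open>  The indices common to \<open>I\<close> and \<open>J\<close> contribute squares, and each square is
  \<open>((Y i)\<^sup>2 - 1) + 1\<close>; the product of these sums is multiplied out.\<close>

lemma monomial_mult_eq_sum_chaos:
  assumes "I \<subseteq> V" "J \<subseteq> V"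
  shows "(\<Prod>i\<in>I. Y i \<omega>) * (\<Prod>i\<in>J. Y i \<omega>) = (\<Sum>K\<in>Pow (I \<inter> J). chaos (sym_diff I J) K \<omega>)"
proof -
  have fin: "finite I" "finite J" using assms finite_V finite_subset by auto
  have "(\<Prod>i\<in>I. Y i \<omega>) = (\<Prod>i\<in>I - J. Y i \<omega>) * (\<Prod>i\<in>I \<inter> J. Y i \<omega>)"
    "(\<Prod>i\<in>J. Y i \<omega>) = (\<Prod>i\<in>J - I. Y i \<omega>) * (\<Prod>i\<in>I \<inter> J. Y i \<omega>)"
    using fin by (subst prod.union_disjoint[symmetric]; auto intro: prod.cong)+
  moreover have "(\<Prod>i\<in>sym_diff I J. Y i \<omega>) = (\<Prod>i\<in>I - J. Y i \<omega>) * (\<Prod>i\<in>J - I. Y i \<omega>)"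
    using fin by (intro prod.union_disjoint) auto
  ultimately have "(\<Prod>i\<in>I. Y i \<omega>) * (\<Prod>i\<in>J. Y i \<omega>)
      = (\<Prod>i\<in>sym_diff I J. Y i \<omega>) * (\<Prod>i\<in>I \<inter> J. ((Y i \<omega>)\<^sup>2 - 1) + 1)"
    by (simp add: prod.distrib power2_eq_square)
  also have "(\<Prod>i\<in>I \<inter> J. ((Y i \<omega>)\<^sup>2 - 1) + 1) = (\<Sum>K\<in>Pow (I \<inter> J). \<Prod>i\<in>K. (Y i \<omega>)\<^sup>2 - 1)"
    using fin by (subst prod_add) auto
  also have "(\<Prod>i\<in>sym_diff I J. Y i \<omega>) * \<dots> = (\<Sum>K\<in>Pow (I \<inter> J). chaos (sym_diff I J) K \<omega>)"
    unfolding sum_distrib_left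
    by (intro sum.cong refl chaos_eq_prod[symmetric]) (use assms in auto)
  finally show ?thesis .
qed

end

section \<open>Pairs of index sets with a given chaos term\<close>

text \<open>  This is the coefficient of \<open>(cmod (A I J))\<^sup>2\<close> in the bound for the off-diagonal quadratic form
  when \<open>card (I - J) = m\<close>. The summand with index \<open>k\<close> collects the chaos terms of \<open>(I, J)\<close> with
  \<open>T = sym_diff I J\<close>, of size \<open>2 * m\<close>, and \<open>k\<close> centred squares. There are \<open>(d - m) choose k\<close> of
  them, and each contributes the block size \<open>2 ^ (2 * m + k)\<close>, the second moment \<open>v ^ k\<close>, and the
  number of pairs from \<open>card_pairs_sym_diff_le\<close>, which comes from applying Cauchy-Schwarz to the sum
  over these pairs.\<close>

definition off_weight :: "nat \<Rightarrow> nat \<Rightarrow> real \<Rightarrow> nat \<Rightarrow> real" where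
  "off_weight n d v m = 4 ^ m * real ((2 * m) choose m)
     * (\<Sum>k\<le>d - m. real ((d - m) choose k) * (2 * v) ^ k * real ((n - 2 * m - k) choose (d - m - k)))"

lemma card_sym_diff_parts:
  assumes "finite I" "finite J" "card I = card J"
  shows "card (I \<inter> J) = card I - card (I - J)" and "card (sym_diff I J) = 2 * card (I - J)"
    and "card (I - J) \<le> card I"
proof -
  have "card I = card (I - J) + card (I \<inter> J)" "card J = card (J - I) + card (I \<inter> J)"
  proof -
    have "I = (I - J) \<union> (I \<inter> J)" "J = (J - I) \<union> (I \<inter> J)" by blast+
    moreover have "card ((I - J) \<union> (I \<inter> J)) = card (I - J) + card (I \<inter> J)"
      "card ((J - I) \<union> (I \<inter> J)) = card (J - I) + card (I \<inter> J)"
      using assms by (auto intro!: card_Un_disjoint)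
    ultimately show "card I = card (I - J) + card (I \<inter> J)" "card J = card (J - I) + card (I \<inter> J)"
      by simp_all
  qed
  moreover have "card (sym_diff I J) = card (I - J) + card (J - I)"
    using assms by (intro card_Un_disjoint) auto
  ultimately show "card (I \<inter> J) = card I - card (I - J)" "card (sym_diff I J) = 2 * card (I - J)"
    "card (I - J) \<le> card I"
    using assms(3) by auto
qed

text \<open>  A pair \<open>(I, J)\<close> with symmetric difference \<open>T\<close> is determined by \<open>I\<close>, and \<open>I\<close> by its trace on
  \<open>T\<close>, which is half of \<open>T\<close>, and by its elements outside \<open>T\<close> and \<open>K\<close>.\<close>

lemma card_pairs_sym_diff_le:
  assumes V: "finite V" and T: "T \<subseteq> V" "card T = 2 * m" and K: "K \<subseteq> V" "T \<inter> K = {}"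
  shows "card {(I, J) \<in> nsets V d \<times> nsets V d. sym_diff I J = T \<and> K \<subseteq> I \<inter> J}
    \<le> ((2 * m) choose m) * ((card V - 2 * m - card K) choose (d - m - card K))"
proof -
  let ?P = "{(I, J) \<in> nsets V d \<times> nsets V d. sym_diff I J = T \<and> K \<subseteq> I \<inter> J}"
  let ?D = "nsets T m \<times> nsets (V - T - K) (d - m - card K)"
  let ?f = "\<lambda>(I, J :: 'a set). (I \<inter> T, I - T - K)"
  have fin: "finite T" "finite K" using V T K by (auto intro: finite_subset)
  have "inj_on ?f ?P"
  proof (rule inj_onI)
    fix e e' assume e: "e \<in> ?P" and e': "e' \<in> ?P" and eq: "?f e = ?f e'"
    obtain I J I' J' where IJ: "e = (I, J)" "e' = (I', J')" by (metis surj_pair)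
    have T1: "sym_diff I J = T" and T2: "sym_diff I' J' = T" and KI: "K \<subseteq> I" "K \<subseteq> I'"
      using e e' IJ by auto
    have eq1: "I \<inter> T = I' \<inter> T" and eq2: "I - T - K = I' - T - K" using eq IJ by auto
    have "I = I \<inter> T \<union> (I - T - K) \<union> K" "I' = I' \<inter> T \<union> (I' - T - K) \<union> K" using KI by auto
    then have "I = I'" using eq1 eq2 by metis
    moreover have "J = sym_diff I T" using T1 by blast
    moreover have "J' = sym_diff I' T" using T2 by blast
    ultimately show "e = e'" using IJ by simp
  qed
  moreover have "?f ` ?P \<subseteq> ?D"
  proof (rule image_subsetI)
    fix e assume e: "e \<in> ?P"
    obtain I J where IJ: "e = (I, J)" by (metis surj_pair)
    have I: "I \<in> nsets V d" and J: "J \<in> nsets V d" and TIJ: "T = sym_diff I J" and KIJ: "K \<subseteq> I \<inter> J"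
      using e IJ by auto
    have finI: "finite I" "finite J" "card I = d" "card J = d" using I J by (auto simp: nsets_def)
    have m: "card (I - J) = m" "card (I \<inter> J) = d - m"
      using card_sym_diff_parts[of I J] finI T TIJ by auto
    have "I \<inter> T = I - J" "I - T = I \<inter> J" using TIJ by auto
    then have "I \<inter> T \<in> nsets T m" using m finI TIJ by (auto simp: nsets_def)
    moreover have "card (I - T - K) = d - m - card K"
      unfolding \<open>I - T = I \<inter> J\<close> using m KIJ fin by (simp add: card_Diff_subset)
    then have "I - T - K \<in> nsets (V - T - K) (d - m - card K)"
      using I by (auto simp: nsets_def)
    ultimately show "?f e \<in> ?D" using IJ by simp
  qed
  ultimately have "card ?P \<le> card ?D"
    using V fin by (intro card_inj_on_le[where f = ?f]) (auto intro!: finite_imp_finite_nsets)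
  also have "\<dots> = ((2 * m) choose m) * ((card V - 2 * m - card K) choose (d - m - card K))"
  proof -
    have "card (V - T - K) = card V - 2 * m - card K"
      using K T fin by (subst card_Diff_subset; auto simp: card_Diff_subset)
    then show ?thesis using T by (simp add: card_cartesian_product)
  qed
  finally show ?thesis .
qed

lemma norm_sum_sq_le_card: "(cmod (\<Sum>e\<in>E. a e))\<^sup>2 \<le> real (card E) * (\<Sum>e\<in>E. (cmod (a e))\<^sup>2)"
proof -
  have "(cmod (\<Sum>e\<in>E. a e))\<^sup>2 \<le> (\<Sum>e\<in>E. 1 * cmod (a e))\<^sup>2"
    by (intro power_mono) (auto intro: norm_sum)
  also have "\<dots> \<le> (\<Sum>e\<in>E. 1\<^sup>2) * (\<Sum>e\<in>E. (cmod (a e))\<^sup>2)" by (rule Cauchy_Schwarz_ineq_sum)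
  finally show ?thesis by simp
qed

section \<open>Second moments of the diagonal and off-diagonal parts\<close>

context standardized_sample
begin

text \<open>  The squared monomials involve only the terms \<open>chaos {} K\<close>, which are pairwise orthogonal; the
  coefficient of such a term is the sum of \<open>b\<close> over the \<open>d\<close>-sets containing \<open>K\<close>.\<close>

lemma diagonal_part:
  fixes b :: "'i set \<Rightarrow> complex"
  assumes d: "1 \<le> d" "d \<le> card V" and b0: "(\<Sum>I\<in>nsets V d. b I) = 0"
  defines "F \<equiv> \<lambda>\<omega>. \<Sum>I\<in>nsets V d. b I * complex_of_real ((\<Prod>i\<in>I. Y i \<omega>)\<^sup>2)"
  shows "integrable M (\<lambda>\<omega>. (cmod (F \<omega>))\<^sup>2)"
    and "(\<integral>\<omega>. (cmod (F \<omega>))\<^sup>2 \<partial>M) \<le> real (card V choose d) * (\<Sum>I\<in>nsets V d. (cmod (b I))\<^sup>2)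
           * (v * real d / real (card V) * exp (v * (real d)\<^sup>2 / real (card V)))"
proof -
  define \<beta> where "\<beta> K = (\<Sum>I | I \<in> nsets V d \<and> K \<subseteq> I. b I)" for K
  have fin: "finite (nsets V d)" using finite_V by (rule finite_imp_finite_nsets)
  have F: "F = (\<lambda>\<omega>. \<Sum>K\<in>Pow V. \<beta> K * complex_of_real (chaos {} K \<omega>))"
  proof
    fix \<omega>
    have "F \<omega> = (\<Sum>I\<in>nsets V d. \<Sum>K | K \<in> Pow V \<and> K \<subseteq> I. b I * complex_of_real (chaos {} K \<omega>))"
      unfolding F_def
    proof (rule sum.cong[OF refl])
      fix I assume "I \<in> nsets V d"
      then have I: "I \<subseteq> V" by (simp add: nsets_def)
      have "(\<Prod>i\<in>I. Y i \<omega>)\<^sup>2 = (\<Sum>K\<in>Pow I. chaos {} K \<omega>)"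
        using monomial_mult_eq_sum_chaos[OF I I] by (simp add: power2_eq_square)
      moreover have "{K \<in> Pow V. K \<subseteq> I} = Pow I" using I by auto
      ultimately show "b I * complex_of_real ((\<Prod>i\<in>I. Y i \<omega>)\<^sup>2)
          = (\<Sum>K | K \<in> Pow V \<and> K \<subseteq> I. b I * complex_of_real (chaos {} K \<omega>))"
        by (simp only: of_real_sum sum_distrib_left)
    qed
    also have "\<dots> = (\<Sum>K\<in>Pow V. \<Sum>I | I \<in> nsets V d \<and> K \<subseteq> I. b I * complex_of_real (chaos {} K \<omega>))"
      by (rule sum.swap_restrict) (use fin finite_V in auto)
    finally show "F \<omega> = (\<Sum>K\<in>Pow V. \<beta> K * complex_of_real (chaos {} K \<omega>))"
      by (simp only: \<beta>_def sum_distrib_right)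
  qed
  have orth: "(\<integral>\<omega>. chaos {} K \<omega> * chaos {} K' \<omega> \<partial>M) = 0" if "K \<in> Pow V" "K' \<in> Pow V" "K \<noteq> K'" for K K'
    using that by (intro chaos_orthogonal) auto
  note block = integral_norm_sum_sq_le[where Q = "Pow V" and g = "chaos {}" and s = "\<lambda>K. K" and c = \<beta> and M = M,
      OF _ integrable_chaos_mult orth]
  show "integrable M (\<lambda>\<omega>. (cmod (F \<omega>))\<^sup>2)"
    unfolding F by (rule block) (use finite_V in auto)
  have "(\<integral>\<omega>. (cmod (F \<omega>))\<^sup>2 \<partial>M)
      \<le> (\<Sum>K\<in>Pow V. real (card {K' \<in> Pow V. K' = K}) * ((cmod (\<beta> K))\<^sup>2 * (\<integral>\<omega>. (chaos {} K \<omega>)\<^sup>2 \<partial>M)))"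
    unfolding F by (rule block) (use finite_V in auto)
  also have "\<dots> = (\<Sum>K\<in>Pow V. v ^ card K * (cmod (\<beta> K))\<^sup>2)"
  proof (rule sum.cong[OF refl])
    fix K assume K: "K \<in> Pow V"
    then have "{K' \<in> Pow V. K' = K} = {K}" by auto
    then show "real (card {K' \<in> Pow V. K' = K}) * ((cmod (\<beta> K))\<^sup>2 * (\<integral>\<omega>. (chaos {} K \<omega>)\<^sup>2 \<partial>M))
        = v ^ card K * (cmod (\<beta> K))\<^sup>2"
      using K by (simp add: integral_chaos_sq)
  qed
  also have "\<dots> \<le> real (card V choose d) * (\<Sum>I\<in>nsets V d. (cmod (b I))\<^sup>2)
           * (v * real d / real (card V) * exp (v * (real d)\<^sup>2 / real (card V)))"
    unfolding \<beta>_def using d by (intro weighted_superset_sums_sq_le finite_V b0 v_nonneg) auto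
  finally show "(\<integral>\<omega>. (cmod (F \<omega>))\<^sup>2 \<partial>M) \<le> \<dots>" .
qed

text \<open>  A disjoint pair with union \<open>T \<union> K\<close> is determined by its first component.\<close>

lemma card_same_support_le:
  assumes "T \<subseteq> V" "K \<subseteq> V"
  shows "card {q' \<in> {(T, K) \<in> Pow V \<times> Pow V. T \<inter> K = {}}. fst q' \<union> snd q' = T \<union> K} \<le> 2 ^ (card T + card K)"
proof -
  have fin: "finite T" "finite K" using assms finite_V finite_subset by auto
  have "card {q' \<in> {(T, K) \<in> Pow V \<times> Pow V. T \<inter> K = {}}. fst q' \<union> snd q' = T \<union> K} \<le> card (Pow (T \<union> K))"
  proof (rule card_inj_on_le[where f = fst])
    show "inj_on fst {q' \<in> {(T, K) \<in> Pow V \<times> Pow V. T \<inter> K = {}}. fst q' \<union> snd q' = T \<union> K}"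
    proof (rule inj_onI, clarsimp)
      fix T' K' K'' assume "T' \<union> K' = T \<union> K" "T' \<union> K'' = T \<union> K" "T' \<inter> K' = {}" "T' \<inter> K'' = {}"
      then have "K' = (T \<union> K) - T'" "K'' = (T \<union> K) - T'" by blast+
      then show "K' = K''" by simp
    qed
  qed (use fin in auto)
  also have "\<dots> = 2 ^ card (T \<union> K)" using fin by (simp add: card_Pow)
  also have "\<dots> \<le> 2 ^ (card T + card K)" by (intro power_increasing card_Un_le) auto
  finally show ?thesis .
qed

text \<open>  The chaos expansion groups the entries \<open>A I J\<close> into the coefficients \<open>B (T, K)\<close>, where \<open>A I J\<close>
  enters if \<open>sym_diff I J = T\<close> and \<open>K \<subseteq> I \<inter> J\<close>. Cauchy-Schwarz inside each \<open>B (T, K)\<close> and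
  the block estimate leave a weighted sum of the \<open>(cmod (A I J))\<^sup>2\<close>, whose weights are collected in
  \<open>off_weight\<close>.\<close>

lemma off_diagonal_part:
  fixes A :: "'i set \<Rightarrow> 'i set \<Rightarrow> complex"
  assumes V: "V \<noteq> {}" and \<kappa>: "\<And>m. 1 \<le> m \<Longrightarrow> m \<le> d \<Longrightarrow> off_weight (card V) d v m \<le> \<kappa>"
  defines "E \<equiv> {(I, J) \<in> nsets V d \<times> nsets V d. I \<noteq> J}"
  defines "F \<equiv> \<lambda>\<omega>. \<Sum>(I, J)\<in>E. A I J * complex_of_real ((\<Prod>i\<in>I. Y i \<omega>) * (\<Prod>i\<in>J. Y i \<omega>))"
  shows "integrable M (\<lambda>\<omega>. (cmod (F \<omega>))\<^sup>2)"
    and "(\<integral>\<omega>. (cmod (F \<omega>))\<^sup>2 \<partial>M) \<le> \<kappa> * (\<Sum>(I, J)\<in>E. (cmod (A I J))\<^sup>2)"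
proof -
  define n where "n = card V"
  define Q where "Q = {(T, K) \<in> Pow V \<times> Pow V. T \<inter> K = {}}"
  define R where "R e q \<longleftrightarrow> (case e of (I, J) \<Rightarrow> sym_diff I J = fst q \<and> snd q \<subseteq> I \<inter> J)"
    for e :: "'i set \<times> 'i set" and q :: "'i set \<times> 'i set"
  define a where "a e = A (fst e) (snd e)" for e
  define B where "B q = (\<Sum>e | e \<in> E \<and> R e q. a e)" for q
  define g where "g q = chaos (fst q) (snd q)" for q
  define N where "N q = real (card {e \<in> E. R e q})" for q
  have v: "0 \<le> v" using V by (rule v_nonneg)
  have fin: "finite (nsets V d)" using finite_V by (rule finite_imp_finite_nsets)
  have finE: "finite E" unfolding E_def by (rule finite_subset[of _ "nsets V d \<times> nsets V d"]) (use fin in auto)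
  have finQ: "finite Q" unfolding Q_def by (rule finite_subset[of _ "Pow V \<times> Pow V"]) (use finite_V in auto)
  have EV: "I \<subseteq> V" "J \<subseteq> V" if "(I, J) \<in> E" for I J
    using that by (auto simp: E_def nsets_def)
  have related: "{q \<in> Q. R (I, J) q} = Pair (sym_diff I J) ` Pow (I \<inter> J)" if "(I, J) \<in> E" for I J
    using EV[OF that] by (auto simp: Q_def R_def)
  have F: "F = (\<lambda>\<omega>. \<Sum>q\<in>Q. B q * complex_of_real (g q \<omega>))"
  proof
    fix \<omega>
    have "F \<omega> = (\<Sum>e\<in>E. \<Sum>q | q \<in> Q \<and> R e q. a e * complex_of_real (g q \<omega>))"
      unfolding F_def
    proof (rule sum.cong[OF refl], clarify)
      fix I J assume IJ: "(I, J) \<in> E"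
      have "A I J * complex_of_real ((\<Prod>i\<in>I. Y i \<omega>) * (\<Prod>i\<in>J. Y i \<omega>))
          = (\<Sum>K\<in>Pow (I \<inter> J). A I J * complex_of_real (chaos (sym_diff I J) K \<omega>))"
        unfolding monomial_mult_eq_sum_chaos[OF EV[OF IJ]] by (simp only: of_real_sum sum_distrib_left)
      also have "\<dots> = (\<Sum>q | q \<in> Q \<and> R (I, J) q. a (I, J) * complex_of_real (g q \<omega>))"
        unfolding related[OF IJ] by (subst sum.reindex) (auto simp: inj_on_def g_def a_def)
      finally show "A I J * complex_of_real ((\<Prod>i\<in>I. Y i \<omega>) * (\<Prod>i\<in>J. Y i \<omega>)) = \<dots>" .
    qed
    also have "\<dots> = (\<Sum>q\<in>Q. \<Sum>e | e \<in> E \<and> R e q. a e * complex_of_real (g q \<omega>))"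
      by (rule sum.swap_restrict[OF finE finQ])
    finally show "F \<omega> = (\<Sum>q\<in>Q. B q * complex_of_real (g q \<omega>))"
      by (simp only: B_def sum_distrib_right)
  qed
  have int: "integrable M (\<lambda>\<omega>. g q \<omega> * g q' \<omega>)" for q q'
    unfolding g_def by (rule integrable_chaos_mult)
  have orth: "(\<integral>\<omega>. g q \<omega> * g q' \<omega> \<partial>M) = 0"
    if "q \<in> Q" "q' \<in> Q" "fst q \<union> snd q \<noteq> fst q' \<union> snd q'" for q q'
    unfolding g_def using that by (intro chaos_orthogonal) (auto simp: Q_def)
  note block = integral_norm_sum_sq_le[where Q = Q and g = g and s = "\<lambda>q. fst q \<union> snd q" and c = B and M = M,
      OF finQ int orth]
  show "integrable M (\<lambda>\<omega>. (cmod (F \<omega>))\<^sup>2)"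
    unfolding F by (rule block)
  define h where "h q = 2 ^ (card (fst q) + card (snd q)) * v ^ card (snd q) * N q" for q :: "'i set \<times> 'i set"
  have weight: "(\<Sum>q | q \<in> Q \<and> R (I, J) q. h q) \<le> \<kappa>" if IJ: "(I, J) \<in> E" for I J
  proof -
    define m where "m = card (I - J)"
    have I: "finite I" "finite J" "card I = d" "card J = d" "I \<noteq> J"
      using IJ by (auto simp: E_def nsets_def)
    have card_sd: "card (sym_diff I J) = 2 * m" and card_Int: "card (I \<inter> J) = d - m" and md: "m \<le> d"
      using card_sym_diff_parts[of I J] I by (auto simp: m_def)
    have "m \<noteq> 0"
    proof
      assume "m = 0"
      then have "sym_diff I J = {}" using card_sd I by simp
      then show False using I by blast
    qed
    define w where "w k = 4 ^ m * real ((2 * m) choose m) * ((2 * v) ^ k * real ((n - 2 * m - k) choose (d - m - k)))" for k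
    have "(\<Sum>q | q \<in> Q \<and> R (I, J) q. h q) = (\<Sum>K\<in>Pow (I \<inter> J). h (sym_diff I J, K))"
      unfolding related[OF IJ] by (subst sum.reindex) (auto simp: inj_on_def)
    also have "\<dots> \<le> (\<Sum>K\<in>Pow (I \<inter> J). w (card K))"
    proof (rule sum_mono)
      fix K assume K: "K \<in> Pow (I \<inter> J)"
      have "{e \<in> E. R e (sym_diff I J, K)}
          \<subseteq> {(I', J') \<in> nsets V d \<times> nsets V d. sym_diff I' J' = sym_diff I J \<and> K \<subseteq> I' \<inter> J'}"
        by (auto simp: E_def R_def)
      then have "card {e \<in> E. R e (sym_diff I J, K)}
          \<le> card {(I', J') \<in> nsets V d \<times> nsets V d. sym_diff I' J' = sym_diff I J \<and> K \<subseteq> I' \<inter> J'}"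
        by (rule card_mono[rotated]) (rule finite_subset[of _ "nsets V d \<times> nsets V d"], use fin in auto)
      also have "\<dots> \<le> ((2 * m) choose m) * ((n - 2 * m - card K) choose (d - m - card K))"
        unfolding n_def by (rule card_pairs_sym_diff_le[OF finite_V _ card_sd]) (use K EV[OF IJ] in auto)
      finally have "N (sym_diff I J, K) \<le> real (((2 * m) choose m) * ((n - 2 * m - card K) choose (d - m - card K)))"
        unfolding N_def by (rule of_nat_mono)
      then have "h (sym_diff I J, K) \<le> 2 ^ (2 * m + card K) * v ^ card K
          * real (((2 * m) choose m) * ((n - 2 * m - card K) choose (d - m - card K)))"
        unfolding h_def using v by (simp add: card_sd mult_left_mono)
      also have "\<dots> = w (card K)"
        by (simp add: w_def power_add power_mult power_mult_distrib)
      finally show "h (sym_diff I J, K) \<le> w (card K)" .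
    qed
    also have "\<dots> = (\<Sum>k\<le>d - m. \<Sum>K\<in>nsets (I \<inter> J) k. w (card K))"
      using sum_Pow_eq_sum_nsets[of "I \<inter> J" "\<lambda>K. w (card K)"] I by (simp add: card_Int)
    also have "\<dots> = (\<Sum>k\<le>d - m. \<Sum>K\<in>nsets (I \<inter> J) k. w k)"
      by (intro sum.cong refl) (simp add: nsets_def)
    also have "\<dots> = off_weight n d v m"
      unfolding off_weight_def sum_distrib_left
      by (intro sum.cong refl) (simp add: card_Int w_def mult_ac)
    also have "\<dots> \<le> \<kappa>" unfolding n_def using \<open>m \<noteq> 0\<close> md by (intro \<kappa>) auto
    finally show ?thesis .
  qed
  have "(\<integral>\<omega>. (cmod (F \<omega>))\<^sup>2 \<partial>M)
      \<le> (\<Sum>q\<in>Q. real (card {q' \<in> Q. fst q' \<union> snd q' = fst q \<union> snd q}) * ((cmod (B q))\<^sup>2 * (\<integral>\<omega>. (g q \<omega>)\<^sup>2 \<partial>M)))"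
    unfolding F by (rule block)
  also have "\<dots> \<le> (\<Sum>q\<in>Q. 2 ^ (card (fst q) + card (snd q)) * (v ^ card (snd q) * (N q * (\<Sum>e | e \<in> E \<and> R e q. (cmod (a e))\<^sup>2))))"
  proof (rule sum_mono)
    fix q assume q: "q \<in> Q"
    have "(\<integral>\<omega>. (g q \<omega>)\<^sup>2 \<partial>M) = v ^ card (snd q)"
      unfolding g_def using q by (intro integral_chaos_sq) (auto simp: Q_def)
    moreover have "(cmod (B q))\<^sup>2 \<le> N q * (\<Sum>e | e \<in> E \<and> R e q. (cmod (a e))\<^sup>2)"
      unfolding B_def N_def by (rule norm_sum_sq_le_card)
    moreover have "real (card {q' \<in> Q. fst q' \<union> snd q' = fst q \<union> snd q}) \<le> 2 ^ (card (fst q) + card (snd q))"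
    proof -
      have "fst q \<subseteq> V" "snd q \<subseteq> V" using q by (auto simp: Q_def)
      from of_nat_mono[OF card_same_support_le[OF this], where 'a = real] show ?thesis
        unfolding Q_def by (simp only: of_nat_power of_nat_numeral)
    qed
    ultimately show "real (card {q' \<in> Q. fst q' \<union> snd q' = fst q \<union> snd q}) * ((cmod (B q))\<^sup>2 * (\<integral>\<omega>. (g q \<omega>)\<^sup>2 \<partial>M))
        \<le> 2 ^ (card (fst q) + card (snd q)) * (v ^ card (snd q) * (N q * (\<Sum>e | e \<in> E \<and> R e q. (cmod (a e))\<^sup>2)))"
    proof (intro mult_mono[of _ "2 ^ _"])
      assume "(cmod (B q))\<^sup>2 \<le> N q * (\<Sum>e | e \<in> E \<and> R e q. (cmod (a e))\<^sup>2)" "(\<integral>\<omega>. (g q \<omega>)\<^sup>2 \<partial>M) = v ^ card (snd q)"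
      then show "(cmod (B q))\<^sup>2 * (\<integral>\<omega>. (g q \<omega>)\<^sup>2 \<partial>M) \<le> v ^ card (snd q) * (N q * (\<Sum>e | e \<in> E \<and> R e q. (cmod (a e))\<^sup>2))"
        using v by (simp add: mult.commute mult_left_mono)
    qed (use v in auto)
  qed
  also have "\<dots> = (\<Sum>q\<in>Q. \<Sum>e | e \<in> E \<and> R e q. h q * (cmod (a e))\<^sup>2)"
    by (simp add: h_def sum_distrib_left mult_ac)
  also have "\<dots> = (\<Sum>e\<in>E. \<Sum>q | q \<in> Q \<and> R e q. h q * (cmod (a e))\<^sup>2)"
    by (rule sum.swap_restrict[OF finE finQ, symmetric])
  also have "\<dots> \<le> (\<Sum>e\<in>E. \<kappa> * (cmod (a e))\<^sup>2)"
  proof (rule sum_mono)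
    fix e assume e: "e \<in> E"
    have "(\<Sum>q | q \<in> Q \<and> R e q. h q) \<le> \<kappa>" using weight[of "fst e" "snd e"] e by simp
    then show "(\<Sum>q | q \<in> Q \<and> R e q. h q * (cmod (a e))\<^sup>2) \<le> \<kappa> * (cmod (a e))\<^sup>2"
      unfolding sum_distrib_right[symmetric] by (intro mult_right_mono) auto
  qed
  also have "\<dots> = \<kappa> * (\<Sum>(I, J)\<in>E. (cmod (A I J))\<^sup>2)"
    by (simp add: sum_distrib_left a_def case_prod_unfold)
  finally show "(\<integral>\<omega>. (cmod (F \<omega>))\<^sup>2 \<partial>M) \<le> \<kappa> * (\<Sum>(I, J)\<in>E. (cmod (A I J))\<^sup>2)" .
qed

end

section \<open>The off-diagonal weight is largest for neighbouring sets\<close>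

lemma central_binomial_Suc_le: "(2 * Suc m) choose Suc m \<le> 4 * ((2 * m) choose m)"
proof -
  have "(2 * m) choose (m - 1) \<le> (2 * m) choose m" "(2 * m) choose (Suc m) \<le> (2 * m) choose m"
    by (rule binomial_maximum')+
  moreover have "Suc (2 * m) choose m \<le> ((2 * m) choose (m - 1)) + ((2 * m) choose m)"
    by (cases m) auto
  ultimately show ?thesis by simp
qed

text \<open>  Passing from \<open>m\<close> to \<open>m + 1\<close> multiplies \<open>4 ^ m\<close> and the central binomial coefficient by at most
  \<open>4\<close> each, while the last factor shrinks at least by the ratio \<open>(d - m) / (n - 2 * m) \<le> 1 / 16\<close>. This is
  where the assumption \<open>16 * d \<le> n\<close> comes from; the value at \<open>m = 1\<close> is the bound.\<close>

lemma central_times_choose_le: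
  assumes "1 \<le> m" "m \<le> d" "16 * d \<le> n"
  shows "4 ^ m * real ((2 * m) choose m) * real ((n - 2 * m) choose (d - m)) \<le> 8 * real ((n - 2) choose (d - 1))"
  using assms(1,2)
proof (induction m rule: dec_induct)
  case base
  then show ?case by simp
next
  case (step m)
  have m: "m < d" "1 \<le> m" using step by auto
  have "real ((n - 2 * Suc m) choose (d - Suc m)) \<le> real ((n - 2 * m - 1) choose (d - m - 1))"
    using m assms(3) by (simp add: binomial_right_mono)
  also have "\<dots> \<le> (real (d - m) / real (n - 2 * m)) ^ 1 * real ((n - 2 * m) choose (d - m))"
    using m assms(3) by (intro choose_diff_le) auto
  also have "\<dots> \<le> 1 / 16 * real ((n - 2 * m) choose (d - m))"
    using m assms(3) by (intro mult_right_mono) (auto simp: field_simps of_nat_diff)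
  finally have "16 * real ((n - 2 * Suc m) choose (d - Suc m)) \<le> real ((n - 2 * m) choose (d - m))" by simp
  moreover have "real ((2 * Suc m) choose Suc m) \<le> 4 * real ((2 * m) choose m)"
    using of_nat_mono[OF central_binomial_Suc_le[of m], where 'a = real] by simp
  ultimately have "real ((2 * Suc m) choose Suc m) * (16 * real ((n - 2 * Suc m) choose (d - Suc m)))
      \<le> (4 * real ((2 * m) choose m)) * real ((n - 2 * m) choose (d - m))"
    by (intro mult_mono) auto
  then have "4 * (real ((2 * Suc m) choose Suc m) * real ((n - 2 * Suc m) choose (d - Suc m)))
      \<le> real ((2 * m) choose m) * real ((n - 2 * m) choose (d - m))"
    by linarith
  then have "4 ^ m * (4 * (real ((2 * Suc m) choose Suc m) * real ((n - 2 * Suc m) choose (d - Suc m))))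
      \<le> 4 ^ m * (real ((2 * m) choose m) * real ((n - 2 * m) choose (d - m)))"
    by (intro mult_left_mono) auto
  also have "\<dots> \<le> 8 * real ((n - 2) choose (d - 1))"
    using step.IH m by (simp add: mult.assoc)
  finally show ?case by (simp add: mult_ac del: binomial_Suc_Suc)
qed

lemma choose_minus_2_eq:
  assumes "1 \<le> d" "d \<le> n" "2 \<le> n"
  shows "real ((n - 2) choose (d - 1)) = real (n choose d) * (real d * (real n - real d) / (real n * (real n - 1)))"
proof -
  have "d * (n choose d) = n * ((n - 1) choose (d - 1))"
    using binomial_absorption[of "d - 1" n] assms by simp
  then have 1: "real d * real (n choose d) = real n * real ((n - 1) choose (d - 1))"
    by (metis of_nat_mult)
  have "(n - d) * ((n - 1) choose (d - 1)) = (n - 1) * ((n - 2) choose (d - 1))"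
    using binomial_absorb_comp[of "n - 1" "d - 1"] assms by (simp add: numeral_2_eq_2)
  then have 2: "(real n - real d) * real ((n - 1) choose (d - 1)) = (real n - 1) * real ((n - 2) choose (d - 1))"
  proof -
    assume eq: "(n - d) * ((n - 1) choose (d - 1)) = (n - 1) * ((n - 2) choose (d - 1))"
    have "real (n - d) * real ((n - 1) choose (d - 1)) = real (n - 1) * real ((n - 2) choose (d - 1))"
      unfolding of_nat_mult[symmetric] eq by (rule refl)
    then show ?thesis using assms by (simp add: of_nat_diff)
  qed
  have "real n * (real n - 1) * real ((n - 2) choose (d - 1)) = real d * (real n - real d) * real (n choose d)"
    using 1 2 by algebra
  then show ?thesis using assms by (simp add: field_simps)
qed

lemma off_weight_nonneg: "0 \<le> v \<Longrightarrow> 0 \<le> off_weight n d v m"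
  unfolding off_weight_def by (intro mult_nonneg_nonneg sum_nonneg) auto

text \<open>  The sum over \<open>k\<close> is bounded by an exponential series in \<open>2 * v * d * \<rho>\<close>, and the remaining
  factor by its value at \<open>m = 1\<close>. The latter is \<open>8 * ((n - 2) choose (d - 1))\<close>, which accounts for
  the prefactor of \<open>eps_off\<close>.\<close>

lemma off_weight_le:
  assumes m: "1 \<le> m" "m \<le> d" and n: "16 * d \<le> n" and v: "0 \<le> v"
  shows "off_weight n d v m \<le> real (n choose d) * eps_off v d n"
proof -
  define \<rho> where "\<rho> = real d / (real n - real d)"
  define C where "C = real ((n - 2 * m) choose (d - m))"
  have nd: "real n - real d > 0" using m n by simp
  have "(\<Sum>k\<le>d - m. real ((d - m) choose k) * (2 * v) ^ k * real ((n - 2 * m - k) choose (d - m - k)))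
      \<le> (\<Sum>k\<le>d - m. real d ^ k / fact k * (2 * v) ^ k * (\<rho> ^ k * C))"
  proof (intro sum_mono mult_mono)
    fix k assume k: "k \<in> {..d - m}"
    have "real ((d - m) choose k) \<le> real (d - m) ^ k / fact k" by (rule choose_le_pow_div_fact)
    also have "\<dots> \<le> real d ^ k / fact k" by (intro divide_right_mono power_mono) auto
    finally show "real ((d - m) choose k) \<le> real d ^ k / fact k" .
    have "real (d - m) * (real n - real d) \<le> real d * real (n - 2 * m)"
    proof -
      have "16 * (real m * real d) \<le> real m * real n"
        using mult_left_mono[of "16 * real d" "real n" "real m"] n by simp
      then have "3 * (real m * real d) \<le> real m * real n" by (smt (verit) mult_nonneg_nonneg of_nat_0_le_iff)
      then have "3 * (real m * real d) \<le> real m * real n + real d * real d" by (simp add: add_increasing2)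
      moreover have eqs: "real (d - m) = real d - real m" "real (n - 2 * m) = real n - 2 * real m" using m n by auto
      ultimately show ?thesis unfolding eqs by (simp add: algebra_simps)
    qed
    then have "real (d - m) / real (n - 2 * m) \<le> \<rho>"
      using m n nd by (simp add: \<rho>_def field_simps)
    then have "(real (d - m) / real (n - 2 * m)) ^ k * C \<le> \<rho> ^ k * C"
      by (intro mult_right_mono power_mono) (auto simp: C_def)
    moreover have "d - m \<le> n - 2 * m" using m n by linarith
    ultimately show "real ((n - 2 * m - k) choose (d - m - k)) \<le> \<rho> ^ k * C"
      using choose_diff_le[of k "d - m" "n - 2 * m"] k unfolding C_def by (meson atMost_iff order_trans)
  qed (use v in auto)
  also have "\<dots> = C * (\<Sum>k\<le>d - m. (2 * v * real d * \<rho>) ^ k /\<^sub>R fact k)"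
    unfolding sum_distrib_left by (intro sum.cong refl) (simp add: power_mult_distrib divide_simps)
  also have "\<dots> \<le> C * exp (2 * v * real d * \<rho>)"
    unfolding exp_def using v nd
    by (intro mult_left_mono sum_le_suminf summable_exp_generic) (auto simp: C_def \<rho>_def)
  also have "2 * v * real d * \<rho> = 2 * v * (real d)\<^sup>2 / (real n - real d)"
    by (simp add: \<rho>_def power2_eq_square)
  finally have "off_weight n d v m \<le> 4 ^ m * real ((2 * m) choose m) * (C * exp (2 * v * (real d)\<^sup>2 / (real n - real d)))"
    unfolding off_weight_def by (intro mult_left_mono) auto
  also have "\<dots> = (4 ^ m * real ((2 * m) choose m) * C) * exp (2 * v * (real d)\<^sup>2 / (real n - real d))"
    by simp
  also have "\<dots> \<le> 8 * real ((n - 2) choose (d - 1)) * exp (2 * v * (real d)\<^sup>2 / (real n - real d))"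
    unfolding C_def by (intro mult_right_mono central_times_choose_le m n) auto
  also have "\<dots> = real (n choose d) * eps_off v d n"
    using choose_minus_2_eq[of d n] m n by (simp add: eps_off_def)
  finally show ?thesis .
qed

section \<open>Operator norm and Frobenius norm\<close>

text \<open>  The column is the image of a standard unit vector.\<close>

lemma column_sq_sum_le_mat_op_norm:
  assumes S: "finite S" and j: "j \<in> S"
  shows "(\<Sum>i\<in>S. (cmod (A i j))\<^sup>2) \<le> (mat_op_norm S A)\<^sup>2"
proof -
  let ?Z = "{z. L2_set (\<lambda>i. cmod (z i)) S \<le> 1}"
  define e where "e k = (if k = j then 1 else 0 :: complex)" for k
  have "L2_set (\<lambda>i. cmod (e i)) S = 1"
  proof -
    have "(\<Sum>i\<in>S. (cmod (e i))\<^sup>2) = (\<Sum>i\<in>S. if i = j then 1 else 0)"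
      by (intro sum.cong) (auto simp: e_def)
    then show ?thesis using S j by (simp add: L2_set_def)
  qed
  then have e: "e \<in> ?Z" by simp
  have "bdd_above ((\<lambda>z. L2_set (\<lambda>i. cmod (\<Sum>j\<in>S. A i j * z j)) S) ` ?Z)"
  proof (rule bdd_aboveI2)
    fix z assume z: "z \<in> ?Z"
    have z1: "cmod (z k) \<le> 1" if "k \<in> S" for k
      using member_le_L2_set[OF S that, of "\<lambda>i. cmod (z i)"] z by simp
    have "L2_set (\<lambda>i. cmod (\<Sum>j\<in>S. A i j * z j)) S \<le> (\<Sum>i\<in>S. cmod (\<Sum>j\<in>S. A i j * z j))"
      by (rule L2_set_le_sum) simp
    also have "\<dots> \<le> (\<Sum>i\<in>S. \<Sum>j\<in>S. cmod (A i j))"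
      by (intro sum_mono order_trans[OF norm_sum]) (auto simp: norm_mult z1 mult_left_le)
    finally show "L2_set (\<lambda>i. cmod (\<Sum>j\<in>S. A i j * z j)) S \<le> (\<Sum>i\<in>S. \<Sum>j\<in>S. cmod (A i j))" .
  qed
  from cSUP_upper[OF e this] have "L2_set (\<lambda>i. cmod (\<Sum>k\<in>S. A i k * e k)) S \<le> mat_op_norm S A"
    by (simp add: mat_op_norm_def)
  moreover have "(\<Sum>k\<in>S. A i k * e k) = A i j" for i
    using S j by (simp add: e_def if_distrib cong: if_cong)
  ultimately have "L2_set (\<lambda>i. cmod (A i j)) S \<le> mat_op_norm S A" by simp
  then have "(L2_set (\<lambda>i. cmod (A i j)) S)\<^sup>2 \<le> (mat_op_norm S A)\<^sup>2"
    by (intro power_mono) auto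
  then show ?thesis by (simp add: L2_set_def sum_nonneg)
qed

lemma frobenius_sq_le_mat_op_norm:
  assumes "finite S"
  shows "(\<Sum>(i, j)\<in>S \<times> S. (cmod (A i j))\<^sup>2) \<le> real (card S) * (mat_op_norm S A)\<^sup>2"
proof -
  have "(\<Sum>(i, j)\<in>S \<times> S. (cmod (A i j))\<^sup>2) = (\<Sum>j\<in>S. \<Sum>i\<in>S. (cmod (A i j))\<^sup>2)"
    by (subst sum.swap) (simp add: sum.cartesian_product)
  also have "\<dots> \<le> (\<Sum>j\<in>S. (mat_op_norm S A)\<^sup>2)"
    by (intro sum_mono column_sq_sum_le_mat_op_norm assms)
  finally show ?thesis by simp
qed

section \<open>Second moment of the quadratic form\<close>

text \<open>  Minkowski's inequality in \<open>L\<^sup>2\<close>. Optimising \<open>2 * x * y \<le> t / s * x\<^sup>2 + s / t * y\<^sup>2\<close> requires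
  \<open>s = sqrt a\<close> and \<open>t = sqrt b\<close>, which may vanish; both are enlarged by \<open>e / 2\<close>, and \<open>e\<close> is
  arbitrary.\<close>

lemma integral_norm_add_sq_le:
  fixes f g :: "'a \<Rightarrow> complex"
  assumes [measurable]: "f \<in> borel_measurable M" "g \<in> borel_measurable M"
    and f: "integrable M (\<lambda>x. (cmod (f x))\<^sup>2)" "(\<integral>x. (cmod (f x))\<^sup>2 \<partial>M) \<le> a"
    and g: "integrable M (\<lambda>x. (cmod (g x))\<^sup>2)" "(\<integral>x. (cmod (g x))\<^sup>2 \<partial>M) \<le> b"
  shows "integrable M (\<lambda>x. (cmod (f x + g x))\<^sup>2)"
    and "(\<integral>x. (cmod (f x + g x))\<^sup>2 \<partial>M) \<le> (sqrt a + sqrt b)\<^sup>2"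
proof -
  let ?I = "\<integral>x. (cmod (f x + g x))\<^sup>2 \<partial>M"
  have "0 \<le> (\<integral>x. (cmod (f x))\<^sup>2 \<partial>M)" "0 \<le> (\<integral>x. (cmod (g x))\<^sup>2 \<partial>M)" by simp_all
  then have ab: "0 \<le> a" "0 \<le> b" using f(2) g(2) by linarith+
  have young: "(cmod (f x + g x))\<^sup>2 \<le> (1 + t / s) * (cmod (f x))\<^sup>2 + (1 + s / t) * (cmod (g x))\<^sup>2"
    if "s > 0" "t > 0" for s t x
  proof -
    have "(cmod (f x + g x))\<^sup>2 \<le> (cmod (f x) + cmod (g x))\<^sup>2"
      by (intro power_mono norm_triangle_ineq) auto
    moreover have "0 \<le> (t * cmod (f x) - s * cmod (g x))\<^sup>2 / (s * t)" using that by simp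
    moreover have "(t * cmod (f x) - s * cmod (g x))\<^sup>2 / (s * t)
        = t / s * (cmod (f x))\<^sup>2 + s / t * (cmod (g x))\<^sup>2 - 2 * (cmod (f x) * cmod (g x))"
      using that by (simp add: power2_eq_square field_simps)
    ultimately show ?thesis by (simp add: power2_sum algebra_simps)
  qed
  show int: "integrable M (\<lambda>x. (cmod (f x + g x))\<^sup>2)"
  proof (rule Bochner_Integration.integrable_bound)
    show "integrable M (\<lambda>x. 2 * (cmod (f x))\<^sup>2 + 2 * (cmod (g x))\<^sup>2)" using f g by simp
    show "AE x in M. norm ((cmod (f x + g x))\<^sup>2) \<le> norm (2 * (cmod (f x))\<^sup>2 + 2 * (cmod (g x))\<^sup>2)"
      using young[of 1 1] by (intro AE_I2) simp
  qed simp
  have "sqrt ?I \<le> sqrt a + sqrt b + e" if e: "e > 0" for e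
  proof -
    define s t where "s = sqrt a + e / 2" and "t = sqrt b + e / 2"
    have st: "s > 0" "t > 0" using e ab by (auto simp: s_def t_def intro: add_nonneg_pos)
    have "a \<le> s\<^sup>2" "b \<le> t\<^sup>2" using e ab by (auto simp: s_def t_def power2_sum)
    have "?I \<le> (\<integral>x. (1 + t / s) * (cmod (f x))\<^sup>2 + (1 + s / t) * (cmod (g x))\<^sup>2 \<partial>M)"
      using int f g st by (intro integral_mono young) auto
    also have "\<dots> = (1 + t / s) * (\<integral>x. (cmod (f x))\<^sup>2 \<partial>M) + (1 + s / t) * (\<integral>x. (cmod (g x))\<^sup>2 \<partial>M)"
      using f g by simp
    also have "\<dots> \<le> (1 + t / s) * s\<^sup>2 + (1 + s / t) * t\<^sup>2"
      using f(2) g(2) \<open>a \<le> s\<^sup>2\<close> \<open>b \<le> t\<^sup>2\<close> st by (intro add_mono mult_left_mono) auto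
    also have "\<dots> = (s + t)\<^sup>2" using st by (simp add: power2_eq_square field_simps)
    finally have "sqrt ?I \<le> s + t" using st by (intro real_le_lsqrt) auto
    then show ?thesis by (simp add: s_def t_def)
  qed
  then have "sqrt ?I \<le> sqrt a + sqrt b" by (rule field_le_epsilon)
  then have "(sqrt ?I)\<^sup>2 \<le> (sqrt a + sqrt b)\<^sup>2" by (intro power_mono) auto
  then show "?I \<le> (sqrt a + sqrt b)\<^sup>2" by simp
qed

text \<open>  Since \<open>R\<^sub>n\<close> is itself the average of the squared coordinates, subtracting \<open>R\<^sub>n * Tr A\<close> amounts to
  subtracting from each diagonal entry of \<open>A\<close> the mean of the diagonal.\<close>

lemma quad_form_dev_eq:
  fixes Y :: "nat \<Rightarrow> 'a \<Rightarrow> real" and A :: "nat set \<Rightarrow> nat set \<Rightarrow> complex" and d n :: nat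
  defines "S \<equiv> nsets {1..n} d" and "p \<equiv> of_nat (n choose d) :: complex"
  shows "quad_form_dev n d Y A \<omega> =
    ((\<Sum>I\<in>S. (A I I - mat_trace S A / p) * complex_of_real ((\<Prod>i\<in>I. Y i \<omega>)\<^sup>2))
     + (\<Sum>(I, J)\<in>{(I, J) \<in> S \<times> S. I \<noteq> J}.
          A I J * complex_of_real ((\<Prod>i\<in>I. Y i \<omega>) * (\<Prod>i\<in>J. Y i \<omega>)))) / p"
proof -
  define x where "x I = (\<Prod>i\<in>I. Y i \<omega>)" for I
  define E where "E = {(I, J) \<in> S \<times> S. I \<noteq> J}"
  have fin: "finite S" unfolding S_def by (rule finite_imp_finite_nsets) simp
  have R: "complex_of_real (tensor_R n d Y \<omega>) = (\<Sum>I\<in>S. complex_of_real ((x I)\<^sup>2)) / p"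
    by (simp add: tensor_R_def L2_set_def sum_nonneg sqfree_tensor_def x_def S_def p_def)
  have "quad_form S A (sqfree_tensor Y \<omega>) = (\<Sum>(I, J)\<in>S \<times> S. A I J * complex_of_real (x I * x J))"
    by (simp add: quad_form_def sqfree_tensor_def x_def sum.cartesian_product mult_ac)
  also have "S \<times> S = E \<union> (\<lambda>I. (I, I)) ` S" by (auto simp: E_def)
  also have "(\<Sum>(I, J)\<in>\<dots>. A I J * complex_of_real (x I * x J))
      = (\<Sum>(I, J)\<in>E. A I J * complex_of_real (x I * x J)) + (\<Sum>I\<in>S. A I I * complex_of_real ((x I)\<^sup>2))"
    using fin
    by (subst sum.union_disjoint)
       (auto simp: E_def sum.reindex inj_on_def power2_eq_square intro: finite_subset[of _ "S \<times> S"])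
  finally have q: "quad_form S A (sqfree_tensor Y \<omega>)
      = (\<Sum>(I, J)\<in>E. A I J * complex_of_real (x I * x J)) + (\<Sum>I\<in>S. A I I * complex_of_real ((x I)\<^sup>2))" .
  have "(\<Sum>I\<in>S. (A I I - mat_trace S A / p) * complex_of_real ((x I)\<^sup>2))
      = (\<Sum>I\<in>S. A I I * complex_of_real ((x I)\<^sup>2)) - mat_trace S A / p * (\<Sum>I\<in>S. complex_of_real ((x I)\<^sup>2))"
    unfolding left_diff_distrib sum_subtractf sum_distrib_left by (rule refl)
  then show ?thesis
    unfolding quad_form_dev_def S_def[symmetric] p_def[symmetric] R q x_def[symmetric] E_def[symmetric]
    by (simp add: add_divide_distrib diff_divide_distrib mult.commute)
qed

text \<open>  Both parts are controlled by the Frobenius norm of \<open>A\<close>, whose square is at most \<open>n choose d\<close> times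
  the squared operator norm. The constants \<open>\<kappa>\<close> and \<open>\<delta>\<close> are left free because the closed forms
  \<open>eps_off\<close> and \<open>eps_diag\<close> bound the weights only when \<open>d\<close> is small compared with \<open>n\<close>.\<close>

lemma quad_form_dev_second_moment_le:
  fixes Y :: "nat \<Rightarrow> 'a \<Rightarrow> real"
  assumes "standardized_sample M {1..n} Y v"
    and d: "1 \<le> d" "d \<le> n"
    and \<kappa>: "\<And>m. 1 \<le> m \<Longrightarrow> m \<le> d \<Longrightarrow> off_weight n d v m \<le> real (n choose d) * \<kappa>"
    and \<delta>: "v * real d / real n * exp (v * (real d)\<^sup>2 / real n) \<le> \<delta>"
  shows "integrable M (\<lambda>\<omega>. (cmod (quad_form_dev n d Y A \<omega>))\<^sup>2)"
    and "(\<integral>\<omega>. (cmod (quad_form_dev n d Y A \<omega>))\<^sup>2 \<partial>M)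
         \<le> (sqrt \<delta> + sqrt \<kappa>)\<^sup>2 * (mat_op_norm (nsets {1..n} d) A)\<^sup>2"
proof -
  interpret standardized_sample M "{1..n}" Y v by fact
  define S where "S = nsets {1..n} d"
  define p where "p = real (n choose d)"
  define L where "L = mat_op_norm S A"
  define b where "b I = A I I - mat_trace S A / of_nat (n choose d)" for I
  define E where "E = {(I, J) \<in> S \<times> S. I \<noteq> J}"
  define f where "f = (\<lambda>\<omega>. \<Sum>I\<in>S. b I * complex_of_real ((\<Prod>i\<in>I. Y i \<omega>)\<^sup>2))"
  define g where "g = (\<lambda>\<omega>. \<Sum>(I, J)\<in>E. A I J * complex_of_real ((\<Prod>i\<in>I. Y i \<omega>) * (\<Prod>i\<in>J. Y i \<omega>)))"
  have p: "p > 0" using d by (simp add: p_def)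
  have v: "0 \<le> v" using d by (intro v_nonneg) auto
  have fin: "finite S" unfolding S_def by (rule finite_imp_finite_nsets) simp
  have cardS: "card S = n choose d" by (simp add: S_def)
  have \<delta>0: "0 \<le> \<delta>" using v by (intro order_trans[OF _ \<delta>]) simp
  have \<kappa>0: "0 \<le> \<kappa>"
  proof -
    have "0 \<le> p * \<kappa>" using \<kappa>[of 1] off_weight_nonneg[OF v, of n d 1] d by (simp add: p_def)
    then show ?thesis using p by (simp add: zero_le_mult_iff)
  qed
  have x_meas: "(\<lambda>\<omega>. \<Prod>i\<in>I. Y i \<omega>) \<in> borel_measurable M" if "I \<in> S" for I
    using that by (intro borel_measurable_prod borel_measurable_Y) (auto simp: S_def nsets_def)
  have complex_meas: "(\<lambda>\<omega>. complex_of_real (h \<omega>)) \<in> borel_measurable M" if "h \<in> borel_measurable M" for h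
    using that by measurable
  have f_meas: "f \<in> borel_measurable M"
    unfolding f_def
    by (intro borel_measurable_sum borel_measurable_times borel_measurable_const complex_meas
        borel_measurable_power x_meas)
  have g_meas: "g \<in> borel_measurable M"
    unfolding g_def case_prod_unfold
    by (intro borel_measurable_sum borel_measurable_times borel_measurable_const complex_meas
        x_meas) (auto simp: E_def)
  have frob: "(\<Sum>(I, J)\<in>S \<times> S. (cmod (A I J))\<^sup>2) \<le> p * L\<^sup>2"
    using frobenius_sq_le_mat_op_norm[OF fin, of A] by (simp add: L_def p_def cardS)
  have b0: "(\<Sum>I\<in>S. b I) = 0"
    using p by (simp add: b_def sum_subtractf mat_trace_def cardS p_def)
  have "(\<Sum>I\<in>S. (cmod (b I))\<^sup>2) \<le> (\<Sum>I\<in>S. (cmod (A I I))\<^sup>2)"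
    using sum_norm_sq_diff_mean[OF fin, of "\<lambda>I. A I I"] by (simp add: b_def mat_trace_def cardS)
  also have "\<dots> = (\<Sum>(I, J)\<in>(\<lambda>I. (I, I)) ` S. (cmod (A I J))\<^sup>2)"
    by (simp add: sum.reindex inj_on_def)
  also have "\<dots> \<le> (\<Sum>(I, J)\<in>S \<times> S. (cmod (A I J))\<^sup>2)"
    using fin by (intro sum_mono2) auto
  finally have b_le: "(\<Sum>I\<in>S. (cmod (b I))\<^sup>2) \<le> p * L\<^sup>2" using frob by linarith
  have A_le: "(\<Sum>(I, J)\<in>E. (cmod (A I J))\<^sup>2) \<le> p * L\<^sup>2"
    by (rule order_trans[OF sum_mono2 frob]) (use fin in \<open>auto simp: E_def\<close>)
  have diag: "integrable M (\<lambda>\<omega>. (cmod (f \<omega>))\<^sup>2)" "(\<integral>\<omega>. (cmod (f \<omega>))\<^sup>2 \<partial>M) \<le> (p * L)\<^sup>2 * \<delta>"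
  proof -
    have d': "d \<le> card {1..n}" using d by simp
    note part = diagonal_part[OF d(1) d' b0[unfolded S_def]]
    show "integrable M (\<lambda>\<omega>. (cmod (f \<omega>))\<^sup>2)" unfolding f_def S_def by (rule part)
    have "(\<integral>\<omega>. (cmod (f \<omega>))\<^sup>2 \<partial>M)
        \<le> p * (\<Sum>I\<in>S. (cmod (b I))\<^sup>2) * (v * real d / real n * exp (v * (real d)\<^sup>2 / real n))"
      using part(2) unfolding f_def S_def p_def by simp
    also have "\<dots> \<le> p * (p * L\<^sup>2) * \<delta>"
      using p v by (intro mult_mono mult_left_mono b_le \<delta>) auto
    finally show "(\<integral>\<omega>. (cmod (f \<omega>))\<^sup>2 \<partial>M) \<le> (p * L)\<^sup>2 * \<delta>" by (simp add: power2_eq_square mult_ac)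
  qed
  have off: "integrable M (\<lambda>\<omega>. (cmod (g \<omega>))\<^sup>2)" "(\<integral>\<omega>. (cmod (g \<omega>))\<^sup>2 \<partial>M) \<le> (p * L)\<^sup>2 * \<kappa>"
  proof -
    have ne: "{1..n} \<noteq> {}" and \<kappa>': "1 \<le> m \<Longrightarrow> m \<le> d \<Longrightarrow> off_weight (card {1..n}) d v m \<le> p * \<kappa>" for m
      using d \<kappa> by (auto simp: p_def)
    note part = off_diagonal_part[of d "p * \<kappa>" A, OF ne \<kappa>']
    show "integrable M (\<lambda>\<omega>. (cmod (g \<omega>))\<^sup>2)" unfolding g_def E_def S_def by (rule part)
    have "(\<integral>\<omega>. (cmod (g \<omega>))\<^sup>2 \<partial>M) \<le> (p * \<kappa>) * (\<Sum>(I, J)\<in>E. (cmod (A I J))\<^sup>2)"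
      unfolding g_def E_def S_def by (rule part)
    also have "\<dots> \<le> (p * \<kappa>) * (p * L\<^sup>2)" using p \<kappa>0 by (intro mult_left_mono A_le) auto
    finally show "(\<integral>\<omega>. (cmod (g \<omega>))\<^sup>2 \<partial>M) \<le> (p * L)\<^sup>2 * \<kappa>" by (simp add: power2_eq_square mult_ac)
  qed
  have "quad_form_dev n d Y A \<omega> = (f \<omega> + g \<omega>) / of_nat (n choose d)" for \<omega>
    unfolding quad_form_dev_eq f_def g_def b_def S_def E_def by (rule refl)
  then have dev: "(cmod (quad_form_dev n d Y A \<omega>))\<^sup>2 = (cmod (f \<omega> + g \<omega>))\<^sup>2 / p\<^sup>2" for \<omega>
    by (simp add: norm_divide power_divide p_def)
  note sum = integral_norm_add_sq_le[OF f_meas g_meas diag off]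
  show "integrable M (\<lambda>\<omega>. (cmod (quad_form_dev n d Y A \<omega>))\<^sup>2)"
    unfolding dev using sum(1) by simp
  have "(\<integral>\<omega>. (cmod (quad_form_dev n d Y A \<omega>))\<^sup>2 \<partial>M) = (\<integral>\<omega>. (cmod (f \<omega> + g \<omega>))\<^sup>2 \<partial>M) / p\<^sup>2"
    unfolding dev by simp
  also have "\<dots> \<le> (sqrt ((p * L)\<^sup>2 * \<delta>) + sqrt ((p * L)\<^sup>2 * \<kappa>))\<^sup>2 / p\<^sup>2"
    by (intro divide_right_mono sum) simp
  also have "\<dots> = (p * \<bar>L\<bar> * (sqrt \<delta> + sqrt \<kappa>))\<^sup>2 / p\<^sup>2"
    using p by (simp add: real_sqrt_mult abs_mult distrib_left)
  also have "\<dots> = (sqrt \<delta> + sqrt \<kappa>)\<^sup>2 * L\<^sup>2"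
    using p by (simp add: power_mult_distrib)
  finally show "(\<integral>\<omega>. (cmod (quad_form_dev n d Y A \<omega>))\<^sup>2 \<partial>M)
      \<le> (sqrt \<delta> + sqrt \<kappa>)\<^sup>2 * (mat_op_norm (nsets {1..n} d) A)\<^sup>2"
    by (simp add: L_def S_def)
qed

section \<open>Transfer of moments and asymptotics\<close>

lemma standardized_sample_if_distr_eq:
  fixes X :: "'a \<Rightarrow> real" and Y :: "'i \<Rightarrow> 'b \<Rightarrow> real"
  assumes X: "X \<in> borel_measurable P" "(\<integral>\<omega>. X \<omega> \<partial>P) = 0" "(\<integral>\<omega>. X \<omega> ^ 2 \<partial>P) = 1"
      "integrable P (\<lambda>\<omega>. X \<omega> ^ 4)" "v = (\<integral>\<omega>. X \<omega> ^ 4 \<partial>P) - 1"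
    and M: "prob_space M" "finite V" "prob_space.indep_vars M (\<lambda>_. borel) Y V"
    and distr: "\<And>i. i \<in> V \<Longrightarrow> distr M borel (Y i) = distr P borel X"
  shows "standardized_sample M V Y v"
proof -
  interpret prob_space M by fact
  have Y: "Y i \<in> borel_measurable M" if "i \<in> V" for i
    using M(3) that by (auto simp: indep_vars_def)
  have moment: "(\<integral>\<omega>. Y i \<omega> ^ k \<partial>M) = (\<integral>\<omega>. X \<omega> ^ k \<partial>P)" if "i \<in> V" for i k
  proof -
    have "(\<integral>\<omega>. Y i \<omega> ^ k \<partial>M) = (\<integral>y. y ^ k \<partial>distr M borel (Y i))"
      by (rule integral_distr[symmetric]) (use Y[OF that] in auto)
    also have "\<dots> = (\<integral>\<omega>. X \<omega> ^ k \<partial>P)"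
      unfolding distr[OF that] by (rule integral_distr) (use X(1) in auto)
    finally show ?thesis .
  qed
  have int: "integrable M (\<lambda>\<omega>. Y i \<omega> ^ 4)" if "i \<in> V" for i
  proof -
    have "integrable (distr M borel (Y i)) (\<lambda>y. y ^ 4)"
      unfolding distr[OF that] using X(1,4) by (subst integrable_distr_eq) auto
    then show ?thesis using Y[OF that] by (subst (asm) integrable_distr_eq) auto
  qed
  have moments: "(\<integral>\<omega>. Y i \<omega> \<partial>M) = 0" "(\<integral>\<omega>. (Y i \<omega>)\<^sup>2 \<partial>M) = 1" "(\<integral>\<omega>. Y i \<omega> ^ 4 \<partial>M) = 1 + v"
    if "i \<in> V" for i
    using moment[OF that, of 1] moment[OF that, of 2] moment[OF that, of 4] X(2,3,5) by simp_all
  show ?thesis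
    by unfold_locales (use M(2,3) int moments in auto)
qed

lemma tendsto_eps_diag:
  assumes r: "(\<lambda>n. real (d n) / real n) \<longlonglongrightarrow> 0" and t: "(\<lambda>n. (real (d n))\<^sup>2 / real n) \<longlonglongrightarrow> lam"
  shows "(\<lambda>n. eps_diag v (d n) n) \<longlonglongrightarrow> 0"
proof -
  let ?r = "\<lambda>n. real (d n) / real n" and ?t = "\<lambda>n. (real (d n))\<^sup>2 / real n"
  have "(\<lambda>n. v * ?r n / (1 - ?r n) * exp (v * ?t n / (1 - ?r n)))
      \<longlonglongrightarrow> v * 0 / (1 - 0) * exp (v * lam / (1 - 0))"
    by (intro tendsto_intros r t) auto
  moreover have "\<forall>\<^sub>F n in sequentially. v * ?r n / (1 - ?r n) * exp (v * ?t n / (1 - ?r n)) = eps_diag v (d n) n"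
    using eventually_gt_at_top[of 0]
  proof eventually_elim
    case (elim n)
    then have "1 - ?r n = (real n - real (d n)) / real n" by (simp add: field_simps)
    with elim show ?case by (simp add: eps_diag_def)
  qed
  ultimately show ?thesis using Lim_transform_eventually by fastforce
qed

lemma tendsto_eps_off:
  assumes r: "(\<lambda>n. real (d n) / real n) \<longlonglongrightarrow> 0" and t: "(\<lambda>n. (real (d n))\<^sup>2 / real n) \<longlonglongrightarrow> lam"
  shows "(\<lambda>n. eps_off v (d n) n) \<longlonglongrightarrow> 0"
proof -
  let ?r = "\<lambda>n. real (d n) / real n" and ?t = "\<lambda>n. (real (d n))\<^sup>2 / real n"
  have "(\<lambda>n. 8 * ?r n * (1 - ?r n) / (1 - 1 / real n) * exp (2 * v * ?t n / (1 - ?r n)))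
      \<longlonglongrightarrow> 8 * 0 * (1 - 0) / (1 - 0) * exp (2 * v * lam / (1 - 0))"
    by (intro tendsto_intros r t lim_1_over_n) auto
  moreover have "\<forall>\<^sub>F n in sequentially.
      8 * ?r n * (1 - ?r n) / (1 - 1 / real n) * exp (2 * v * ?t n / (1 - ?r n)) = eps_off v (d n) n"
    using eventually_gt_at_top[of 1]
  proof eventually_elim
    case (elim n)
    then have "1 - ?r n = (real n - real (d n)) / real n" "1 - 1 / real n = (real n - 1) / real n"
      by (simp_all add: field_simps)
    with elim show ?case by (simp add: eps_off_def)
  qed
  ultimately show ?thesis using Lim_transform_eventually by fastforce
qed

theorem theorem5p2:
  fixes P :: "'a measure" and X :: "'a \<Rightarrow> real"
    and M :: "nat \<Rightarrow> 'b measure" and Y :: "nat \<Rightarrow> nat \<Rightarrow> 'b \<Rightarrow> real"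
    and d N :: "nat \<Rightarrow> nat" and v lam c :: real
  assumes "prob_space P"
    and "X \<in> borel_measurable P"
    and "(\<integral>\<omega>. X \<omega> \<partial>P) = 0"
    and "(\<integral>\<omega>. X \<omega> ^ 2 \<partial>P) = 1"
    and "integrable P (\<lambda>\<omega>. X \<omega> ^ 4)"
    and "v = (\<integral>\<omega>. X \<omega> ^ 4 \<partial>P) - 1"
    and "\<And>n. n \<ge> 1 \<Longrightarrow> 1 \<le> d n \<and> d n \<le> n"
    and "\<And>n. n \<ge> 1 \<Longrightarrow> N n \<ge> 1"
    and "(\<lambda>n. (real (d n))\<^sup>2 / real n) \<longlonglongrightarrow> lam" and "0 \<le> lam"
    and "(\<lambda>n. real (n choose d n) / real (N n)) \<longlonglongrightarrow> c" and "0 < c"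
    and "\<And>n. n \<ge> 1 \<Longrightarrow> prob_space (M n)"
    and "\<And>n. n \<ge> 1 \<Longrightarrow> prob_space.indep_vars (M n) (\<lambda>_. borel) (Y n) {1..n}"
    and "\<And>n i. n \<ge> 1 \<Longrightarrow> i \<in> {1..n} \<Longrightarrow> distr (M n) borel (Y n i) = distr P borel X"
  shows "\<exists>eps :: nat \<Rightarrow> real.
      eps \<longlonglongrightarrow> 0
    \<and> (\<forall>n\<ge>1. \<forall>A :: nat set \<Rightarrow> nat set \<Rightarrow> complex.
          integrable (M n) (\<lambda>\<omega>. (cmod (quad_form_dev n (d n) (Y n) A \<omega>))\<^sup>2)
        \<and> (\<integral>\<omega>. (cmod (quad_form_dev n (d n) (Y n) A \<omega>))\<^sup>2 \<partial>M n)
            \<le> eps n * (mat_op_norm (nsets {1..n} (d n)) A)\<^sup>2)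
    \<and> (\<forall>\<^sub>F n in sequentially.
          eps n = (sqrt (eps_diag v (d n) n) + sqrt (eps_off v (d n) n))\<^sup>2)"
proof -
  have sample: "standardized_sample (M n) {1..n} (Y n) v" if "n \<ge> 1" for n
    by (rule standardized_sample_if_distr_eq[OF assms(2-6)]) (use assms(13-15) that in auto)
  have v: "0 \<le> v"
    using standardized_sample.v_nonneg[OF sample[of 1]] by simp
  have r: "(\<lambda>n. real (d n) / real n) \<longlonglongrightarrow> 0"
  proof -
    \<comment> \<open>\<open>(d / n)\<^sup>2\<close> is \<open>d\<^sup>2 / n\<close>, which is bounded, times \<open>1 / n\<close>.\<close>
    have "(\<lambda>n. sqrt ((real (d n))\<^sup>2 / real n * (1 / real n))) \<longlonglongrightarrow> sqrt (lam * 0)"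
      by (intro tendsto_real_sqrt tendsto_mult assms(9) lim_1_over_n)
    moreover have "sqrt ((real (d n))\<^sup>2 / real n * (1 / real n)) = real (d n) / real n" for n
      by (simp add: real_sqrt_divide real_sqrt_mult flip: power2_eq_square)
    ultimately show ?thesis by simp
  qed
  \<comment> \<open>For the finitely many \<open>n\<close> with \<open>n < 16 * d n\<close>, any finite constant independent of \<open>A\<close> will do;
    the sum of all off-diagonal weights provides one.\<close>
  define rate where "rate n = (sqrt (eps_diag v (d n) n) + sqrt (eps_off v (d n) n))\<^sup>2" for n
  define \<kappa> where "\<kappa> n = (\<Sum>m=1..d n. off_weight n (d n) v m) / real (n choose d n)" for n
  define eps where "eps n = (if 16 * d n \<le> n then rate n
      else (sqrt (v * real (d n) / real n * exp (v * (real (d n))\<^sup>2 / real n)) + sqrt (\<kappa> n))\<^sup>2)" for n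
  have eventually_eq: "\<forall>\<^sub>F n in sequentially. eps n = rate n"
  proof -
    have "\<forall>\<^sub>F n in sequentially. real (d n) / real n < 1 / 16"
      using r by (rule order_tendstoD) simp
    then show ?thesis
      using eventually_gt_at_top[of 0]
    proof eventually_elim
      case (elim n)
      then have "16 * real (d n) \<le> real n" by (simp add: field_simps)
      then show ?case by (simp add: eps_def)
    qed
  qed
  have "rate \<longlonglongrightarrow> (sqrt 0 + sqrt 0)\<^sup>2"
    unfolding rate_def by (intro tendsto_intros tendsto_eps_diag[OF r assms(9)] tendsto_eps_off[OF r assms(9)])
  then have lim: "eps \<longlonglongrightarrow> 0"
    using Lim_transform_eventually[of rate _ sequentially eps] eventually_eq by (simp add: eq_commute)
  have bound: "integrable (M n) (\<lambda>\<omega>. (cmod (quad_form_dev n (d n) (Y n) A \<omega>))\<^sup>2)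
      \<and> (\<integral>\<omega>. (cmod (quad_form_dev n (d n) (Y n) A \<omega>))\<^sup>2 \<partial>M n)
          \<le> eps n * (mat_op_norm (nsets {1..n} (d n)) A)\<^sup>2" if n: "n \<ge> 1" for n and A :: "nat set \<Rightarrow> nat set \<Rightarrow> complex"
  proof (cases "16 * d n \<le> n")
    case True
    have d: "1 \<le> d n" "d n \<le> n" using assms(7)[OF n] by auto
    have nd: "0 < real n - real (d n)" "real n - real (d n) \<le> real n" using True d by auto
    have \<delta>: "v * real (d n) / real n * exp (v * (real (d n))\<^sup>2 / real n) \<le> eps_diag v (d n) n"
      unfolding eps_diag_def using v nd
      by (intro mult_mono divide_left_mono) (auto intro!: divide_left_mono mult_nonneg_nonneg)
    show ?thesis
      using quad_form_dev_second_moment_le[OF sample[OF n] d off_weight_le[OF _ _ True v] \<delta>] True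
      by (simp add: eps_def rate_def)
  next
    case False
    have d: "1 \<le> d n" "d n \<le> n" using assms(7)[OF n] by auto
    have "off_weight n (d n) v m \<le> real (n choose d n) * \<kappa> n" if "1 \<le> m" "m \<le> d n" for m
    proof -
      have "off_weight n (d n) v m \<le> (\<Sum>m=1..d n. off_weight n (d n) v m)"
        using that by (intro member_le_sum off_weight_nonneg v) auto
      then show ?thesis using d by (simp add: \<kappa>_def)
    qed
    from quad_form_dev_second_moment_le[OF sample[OF n] d this order_refl] False show ?thesis
      by (simp add: eps_def)
  qed
  show ?thesis
    using lim bound eventually_eq unfolding rate_def by blast
qed

end
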